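(* Suppose that the following hold. (A1) The functions $F,g_1,\dots,g_m$ belong to $C^h(\mathbb{R}^d;\mathbb{R}^d)$ for some integer $h\ge 1$, and, with $g=[g_1,\dots,g_m]$ the matrix whose columns are the $g_i$: (i) there exists $r\ge 0$ such that for every $j=0,1,\dots,h$ and every multiindex $\beta$ with $|\beta|=j$, $\sup_{y\in\mathbb{R}^d}\|D^\beta F(y)\|\,(1+\|y\|^{2r+1-j})^{-1}<\infty$; (ii) there exists $\rho\le r$ such that for every $j=0,1,\dots,h$, every multiindex $\beta$ with $|\beta|=j$ and every $i$, $\sup_{y\in\mathbb{R}^d}\|D^\beta g_i(y)\|\,(1+\|y\|^{\rho-j})^{-1}<\infty$; (iii) for all $p>0$ there exists $K=K(p)\in\mathbb{R}$ such that $\langle y,\mathbf{D}F(z)y\rangle+p\|\mathbf{D}g(z)y\|^2\le K\|y\|^2$ for all $y,z\in\mathbb{R}^d$. (A4) There exists $K>0$ such that $\|g_i(y)-g_i(z)\|\le K\|y-z\|$ for all $y,z\in\mathbb{R}^d$ and $i=1,\dots,m$. Let $Y_n^N$ be the tamed GBM approximation defined in the context. Then for all $p\in[1,\infty)$, $$\sup_{N\in\mathbb{N}}\ \sup_{0\le n\le N}\ \mathbb{E}\left[\|Y_n^N\|^p\right]<\infty .$$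
   Context: Let $d,m\in\mathbb{N}$ and $T>0$. Let $W_t=(W_t^1,\dots,W_t^m)$, $t\in[0,T]$, be independent standard real Brownian motions on a probability space $(\Omega,\mathcal{F},\mathbb{P})$ with filtration $(\mathcal{F}_t)_{t\in[0,T]}$. Let $A,B_1,\dots,B_m\in\mathbb{R}^{d\times d}$ satisfy $AB_i=B_iA$ and $B_iB_j=B_jB_i$ for all $i,j$; let $F,g_1,\dots,g_m:\mathbb{R}^d\to\mathbb{R}^d$ and $x\in\mathbb{R}^d$ (deterministic). $\langle\cdot,\cdot\rangle$ and $\|\cdot\|$ are the Euclidean inner product and norm; $\|\cdot\|$ also denotes the induced matrix norm. $D^\beta$ is the partial derivative for a multiindex $\beta$; $\mathbf{D}$ is the Jacobian, and $\mathbf{D}g(z)y$ is the matrix with columns $\mathbf{D}g_i(z)y$. For $0\le s\le t\le T$ set $$\mathbf{\Phi}_{t,s}=\exp\Big(\big(A-\tfrac12\sum_{i=1}^m B_i^2\big)(t-s)+\sum_{i=1}^m B_i(W_t^i-W_s^i)\Big).$$ Taming: the real-valued taming function $\alpha(\Delta t,y)$ is assumed to satisfy, for all $y\in\mathbb{R}^d$ and $\Delta t>0$, $$\|\alpha(\Delta t,y)F(y)\|\Delta t\le 1,\qquad 0\le\alpha(\Delta t,y)\le 1,\qquad |\alpha(\Delta t,y)-1|\le C\Delta t,$$ where $C>0$ is a constant independent of $\Delta t$. Set $F^{tm}_{\Delta t}(y)=\alpha(\Delta t,y)F(y)$. Tamed GBM method: for $N\in\mathbb{N}$ let $\Delta t=T/N$,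 $t_n=n\Delta t$, $\Delta W_n^i=W^i_{t_{n+1}}-W^i_{t_n}$, $Y_0^N=x$ and, for $n=0,\dots,N-1$, $$Y_{n+1}^N=\mathbf{\Phi}_{t_{n+1},t_n}\Big(Y_n^N+\Big(F^{tm}_{\Delta t}(Y_n^N)-\sum_{i=1}^m B_ig_i(Y_n^N)\Big)\Delta t+\sum_{i=1}^m g_i(Y_n^N)\Delta W_n^i\Big).$$ *)

theory Defs
  imports "HOL-Analysis.Analysis" "HOL-Probability.Probability"
begin

(* On real^'d^'d the class operations of multiplication and power act componentwise, so the
   library's power and exp do not give the matrix power and the matrix exponential. *)
primrec matrix_pow :: "real^'d^'d \<Rightarrow> nat \<Rightarrow> real^'d^'d" where
  "matrix_pow A 0 = mat 1"
| "matrix_pow A (Suc k) = A ** matrix_pow A k"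

definition matrix_exp :: "real^'d^'d \<Rightarrow> real^'d^'d" where
  "matrix_exp A = (\<Sum>k. (1 / fact k) *\<^sub>R matrix_pow A k)"

definition partial_deriv :: "'d \<Rightarrow> (real^'d \<Rightarrow> real^'d) \<Rightarrow> real^'d \<Rightarrow> real^'d" where
  "partial_deriv k f y = frechet_derivative f (at y) (axis k 1)"

primrec C_class :: "nat \<Rightarrow> (real^'d \<Rightarrow> real^'d) \<Rightarrow> bool" where
  "C_class 0 f \<longleftrightarrow> continuous_on UNIV f"
| "C_class (Suc h) f \<longleftrightarrow>
     (\<forall>y. f differentiable (at y)) \<and> (\<forall>k. C_class h (partial_deriv k f))"

(* The partial derivative for the multiindex \<beta>. The index type carries no order, so some
   sequence of directions containing each k exactly \<beta> k times is used; for f of class C^h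
   and |\<beta>| \<le> h the result does not depend on this choice, by symmetry of higher
   derivatives. *)
definition multi_deriv :: "('d::finite \<Rightarrow> nat) \<Rightarrow> (real^'d \<Rightarrow> real^'d) \<Rightarrow> real^'d \<Rightarrow> real^'d" where
  "multi_deriv \<beta> f = foldr partial_deriv (SOME ks. \<forall>k. count_list ks k = \<beta> k) f"

(* The exponent q - j may be negative or zero. The convention 0 powr a = 0 then only affects
   the single point y = 0, hence not whether the set is bounded. *)
definition deriv_growth :: "nat \<Rightarrow> real \<Rightarrow> (real^'d \<Rightarrow> real^'d) \<Rightarrow> bool" where
  "deriv_growth h q f \<longleftrightarrow>
     (\<forall>j\<le>h. \<forall>\<beta>. (\<Sum>k\<in>UNIV. \<beta> k) = j \<longrightarrow>
        bdd_above (range (\<lambda>y. norm (multi_deriv \<beta> f y) * inverse (1 + norm y powr (q - real j)))))"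

definition jacobian_columns :: "('m \<Rightarrow> real^'d \<Rightarrow> real^'d) \<Rightarrow> real^'d \<Rightarrow> real^'d \<Rightarrow> real^'m^'d" where
  "jacobian_columns g z y = (\<chi> k i. (jacobian (g i) (at z) *v y) $ k)"

(* The norm of the type real^'m^'d is the Frobenius norm; this is the one induced by the
   Euclidean norms. *)
definition matrix_norm :: "real^'m^'d \<Rightarrow> real" where
  "matrix_norm G = onorm (\<lambda>v. G *v v)"

definition filtration_on :: "'a measure \<Rightarrow> real \<Rightarrow> (real \<Rightarrow> 'a measure) \<Rightarrow> bool" where
  "filtration_on M T \<F> \<longleftrightarrow>
     (\<forall>t\<in>{0..T}. subalgebra M (\<F> t)) \<and>
     (\<forall>s t. 0 \<le> s \<and> s \<le> t \<and> t \<le> T \<longrightarrow> subalgebra (\<F> t) (\<F> s))"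

definition brownian_motion_on ::
    "'a measure \<Rightarrow> real \<Rightarrow> (real \<Rightarrow> 'a measure) \<Rightarrow> (real \<Rightarrow> 'a \<Rightarrow> real) \<Rightarrow> bool" where
  "brownian_motion_on M T \<F> W \<longleftrightarrow>
     (\<forall>t\<in>{0..T}. W t \<in> borel_measurable (\<F> t)) \<and>
     (AE \<omega> in M. W 0 \<omega> = 0) \<and>
     (AE \<omega> in M. continuous_on {0..T} (\<lambda>t. W t \<omega>)) \<and>
     (\<forall>s t. 0 \<le> s \<and> s < t \<and> t \<le> T \<longrightarrow>
        distributed M lborel (\<lambda>\<omega>. W t \<omega> - W s \<omega>) (normal_density 0 (sqrt (t - s))) \<and>
        prob_space.indep_set M (sets (\<F> s))
          {(\<lambda>\<omega>. W t \<omega> - W s \<omega>) -` S \<inter> space M |S. S \<in> sets borel})"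

definition independent_brownian_motions ::
    "'a measure \<Rightarrow> real \<Rightarrow> (real \<Rightarrow> 'a measure) \<Rightarrow> ('m \<Rightarrow> real \<Rightarrow> 'a \<Rightarrow> real) \<Rightarrow> bool" where
  "independent_brownian_motions M T \<F> W \<longleftrightarrow>
     (\<forall>i. brownian_motion_on M T \<F> (W i)) \<and>
     prob_space.indep_vars M (\<lambda>i. Pi\<^sub>M {0..T} (\<lambda>_. borel)) (\<lambda>i \<omega>. \<lambda>t\<in>{0..T}. W i t \<omega>) UNIV"

(* The constant in the last condition is independent of the step size but may depend on y: a
   constant uniform in y would, together with the first condition, force F to be bounded.
   Measurability is what makes the numerical approximation a random variable. *)
definition taming_function :: "(real^'d \<Rightarrow> real^'d) \<Rightarrow> (real \<Rightarrow> real^'d \<Rightarrow> real) \<Rightarrow> bool" where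
  "taming_function F \<alpha> \<longleftrightarrow>
     (\<forall>\<Delta>>0. \<alpha> \<Delta> \<in> borel_measurable borel) \<and>
     (\<forall>y. \<forall>\<Delta>>0. norm (\<alpha> \<Delta> y *\<^sub>R F y) * \<Delta> \<le> 1) \<and>
     (\<forall>y. \<forall>\<Delta>>0. 0 \<le> \<alpha> \<Delta> y \<and> \<alpha> \<Delta> y \<le> 1) \<and>
     (\<forall>y. \<exists>C>0. \<forall>\<Delta>>0. \<bar>\<alpha> \<Delta> y - 1\<bar> \<le> C * \<Delta>)"

definition gbm_flow ::
    "real^'d^'d \<Rightarrow> ('m::finite \<Rightarrow> real^'d^'d) \<Rightarrow> ('m \<Rightarrow> real \<Rightarrow> 'a \<Rightarrow> real) \<Rightarrow>
     real \<Rightarrow> real \<Rightarrow> 'a \<Rightarrow> real^'d^'d" where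
  "gbm_flow A B W t s \<omega> =
     matrix_exp ((t - s) *\<^sub>R (A - (1/2) *\<^sub>R (\<Sum>i\<in>UNIV. B i ** B i))
       + (\<Sum>i\<in>UNIV. (W i t \<omega> - W i s \<omega>) *\<^sub>R B i))"

primrec tamed_gbm ::
    "real^'d^'d \<Rightarrow> ('m::finite \<Rightarrow> real^'d^'d) \<Rightarrow> (real^'d \<Rightarrow> real^'d) \<Rightarrow> ('m \<Rightarrow> real^'d \<Rightarrow> real^'d) \<Rightarrow>
     (real \<Rightarrow> real^'d \<Rightarrow> real) \<Rightarrow> ('m \<Rightarrow> real \<Rightarrow> 'a \<Rightarrow> real) \<Rightarrow> real \<Rightarrow> real^'d \<Rightarrow>
     nat \<Rightarrow> nat \<Rightarrow> 'a \<Rightarrow> real^'d" where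
  "tamed_gbm A B F g \<alpha> W T x N 0 = (\<lambda>\<omega>. x)"
| "tamed_gbm A B F g \<alpha> W T x N (Suc n) = (\<lambda>\<omega>.
     let \<Delta> = T / real N; t = real n * \<Delta>; t' = real (Suc n) * \<Delta>;
         y = tamed_gbm A B F g \<alpha> W T x N n \<omega>
     in gbm_flow A B W t' t \<omega> *v
          (y + \<Delta> *\<^sub>R (\<alpha> \<Delta> y *\<^sub>R F y - (\<Sum>i\<in>UNIV. B i *v g i y))
             + (\<Sum>i\<in>UNIV. (W i t' \<omega> - W i t \<omega>) *\<^sub>R g i y)))"

end

theory Submission
  imports Defs
begin

text \<open>The tamed increment \<open>\<Delta> \<alpha> F\<close> is only known to have norm at most one, so its square
contributes up to one, not \<open>O(\<Delta>)\<close>, to the square of the norm in each of the \<open>N\<close> steps. What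
makes the moments bounded all the same is that a large drift must point inwards. The Jacobian
bound makes \<open>F\<close> one-sided Lipschitz; testing this between \<open>y\<close> and the point \<open>w\<close> of length
\<open>1/2\<close> in the direction opposite to \<open>F y\<close> gives
\<open>\<langle>y, F y\<rangle> + \<parallel>F y\<parallel> / 2 \<le> C (1 + \<parallel>y\<parallel>\<^sup>2)\<close> (lemma \<open>one_sided_lipschitz_coercive\<close>).
With \<open>h = \<Delta> \<alpha>\<close> and \<open>h \<parallel>F y\<parallel> \<le> 1\<close> the dangerous term satisfies
\<open>h\<^sup>2 \<parallel>F y\<parallel>\<^sup>2 \<le> h \<parallel>F y\<parallel>\<close> and is absorbed by the inner product, so that
\<open>\<parallel>y + h F y\<parallel>\<^sup>2 \<le> \<parallel>y\<parallel>\<^sup>2 + 2 C \<Delta> (1 + \<parallel>y\<parallel>\<^sup>2)\<close> (lemma \<open>tamed_drift_step\<close>).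

The rest is a Lyapunov argument with \<open>V y = (1 + \<parallel>y\<parallel>\<^sup>2) ^ k\<close>, where \<open>k \<ge> p\<close>. Put
\<open>u = y + \<Delta> \<alpha> F y\<close>, let \<open>\<xi>\<close> be the vector of Brownian increments and
\<open>\<tau> = sqrt \<Delta> + (\<Sum>i. \<bar>\<xi> i\<bar>)\<close>, the natural size of one step. Expanding the matrix
exponential to first order, the next iterate is \<open>u + L + R\<close> with \<open>L\<close> linear in \<open>\<xi>\<close>
and \<open>R\<close> of order \<open>\<tau>\<^sup>2\<close> up to a factor \<open>exp (c \<tau>)\<close> (lemma \<open>gbm_step_expansion\<close>).
Hence \<open>V\<close> of the next iterate is at most
\<open>V y * (1 + linear in \<xi> + K \<tau>\<^sup>2 exp (\<kappa> \<tau>))\<close> (lemmas \<open>lyapunov_power_expansion\<close> and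
\<open>tamed_step_lyapunov\<close>). The increments are centred and independent of the past, so the
linear term has mean zero, while \<open>\<tau>\<^sup>2 exp (\<kappa> \<tau>)\<close> has mean \<open>O(\<Delta>)\<close> by Gaussian scaling
(lemma \<open>gaussian_step_expectation\<close>). Thus the mean of \<open>V\<close> grows at most by a factor
\<open>1 + c \<Delta>\<close> per step, and \<open>(1 + c \<Delta>) ^ n \<le> exp (c T)\<close> for \<open>n \<le> N\<close>.\<close>

section \<open>Frobenius norm and the matrix exponential\<close>

text \<open>The norm of \<open>real^'n^'m\<close> is the Frobenius norm; each of the following bounds applies the
Cauchy-Schwarz inequality to the rows. They serve to dominate the exponential series.\<close>

lemma norm_matrix_vector_le:
  fixes A :: "real^'n^'m"
  shows "norm (A *v v) \<le> norm A * norm v"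
proof -
  have "norm (A *v v) = L2_set (\<lambda>i. \<bar>inner (A $ i) v\<bar>) UNIV"
    by (simp add: norm_vec_def matrix_vector_mul_component)
  also have "\<dots> \<le> L2_set (\<lambda>i. norm (A $ i) * norm v) UNIV"
    by (intro L2_set_mono) (auto simp: Cauchy_Schwarz_ineq2)
  also have "\<dots> = norm A * norm v"
    by (simp add: L2_set_left_distrib[symmetric] norm_vec_def)
  finally show ?thesis .
qed

lemma norm_vector_matrix_le:
  fixes B :: "real^'n^'m"
  shows "norm (v v* B) \<le> norm v * norm B"
proof -
  have "v v* B = (\<Sum>i\<in>UNIV. v $ i *\<^sub>R B $ i)"
    by (simp add: vec_eq_iff vector_matrix_mult_def mult.commute)
  then have "norm (v v* B) \<le> (\<Sum>i\<in>UNIV. norm (v $ i *\<^sub>R B $ i))"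
    by (simp only: norm_sum)
  also have "\<dots> = (\<Sum>i\<in>UNIV. \<bar>norm (v $ i)\<bar> * \<bar>norm (B $ i)\<bar>)" by simp
  also have "\<dots> \<le> L2_set (\<lambda>i. norm (v $ i)) UNIV * L2_set (\<lambda>i. norm (B $ i)) UNIV"
    by (rule L2_set_mult_ineq)
  finally show ?thesis by (simp add: norm_vec_def)
qed

lemma norm_matrix_matrix_le:
  fixes A :: "real^'n^'m" and B :: "real^'k^'n"
  shows "norm (A ** B) \<le> norm A * norm B"
proof -
  have row: "(A ** B) $ i = A $ i v* B" for i
    by (simp add: vec_eq_iff matrix_matrix_mult_def vector_matrix_mult_def mult.commute)
  have "norm (A ** B) = L2_set (\<lambda>i. norm (A $ i v* B)) UNIV"
    by (simp add: norm_vec_def[of "A ** B"] row)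
  also have "\<dots> \<le> L2_set (\<lambda>i. norm (A $ i) * norm B) UNIV"
    by (intro L2_set_mono norm_vector_matrix_le) auto
  also have "\<dots> = norm A * norm B"
    by (simp add: L2_set_left_distrib[symmetric] norm_vec_def[of A])
  finally show ?thesis .
qed

lemma norm_matrix_pow_le:
  "norm (matrix_pow A k) \<le> norm A ^ k * norm (mat 1 :: real^'d^'d)" for A :: "real^'d^'d"
proof (induction k)
  case (Suc k)
  have "norm (matrix_pow A (Suc k)) \<le> norm A * norm (matrix_pow A k)"
    by (simp add: norm_matrix_matrix_le)
  also have "\<dots> \<le> norm A * (norm A ^ k * norm (mat 1 :: real^'d^'d))"
    by (intro mult_left_mono Suc.IH) auto
  finally show ?case by (simp add: mult.assoc)
qed simp

lemma norm_matrix_pow_vector_le: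
  "norm (matrix_pow A k *v v) \<le> norm A ^ k * norm v" for A :: "real^'d^'d"
proof (induction k)
  case (Suc k)
  have "norm (matrix_pow A (Suc k) *v v) \<le> norm A * norm (matrix_pow A k *v v)"
    by (simp add: matrix_vector_mul_assoc[symmetric] norm_matrix_vector_le)
  also have "\<dots> \<le> norm A * (norm A ^ k * norm v)"
    by (intro mult_left_mono Suc.IH) auto
  finally show ?case by (simp add: mult.assoc)
qed simp

lemma summable_matrix_exp:
  "summable (\<lambda>k. (1 / fact k) *\<^sub>R matrix_pow A k)" for A :: "real^'d^'d"
proof (rule summable_comparison_test')
  show "summable (\<lambda>k. inverse (fact k) * norm A ^ k * norm (mat 1 :: real^'d^'d))"
    by (intro summable_mult2 summable_exp)
  show "norm ((1 / fact k) *\<^sub>R matrix_pow A k)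
      \<le> inverse (fact k) * norm A ^ k * norm (mat 1 :: real^'d^'d)" for k
    using mult_left_mono[OF norm_matrix_pow_le[of A k], of "inverse (fact k)"]
    by (simp add: divide_inverse mult.assoc)
qed

lemma matrix_exp_vector_sums:
  "(\<lambda>k. (1 / fact k) *\<^sub>R (matrix_pow A k *v v)) sums (matrix_exp A *v v)"
  for A :: "real^'d^'d"
proof -
  have lin: "bounded_linear (\<lambda>M :: real^'d^'d. M *v v)"
    by (intro linear_conv_bounded_linear[THEN iffD1] linearI)
       (auto simp: matrix_vector_mult_add_rdistrib scaleR_matrix_vector_assoc)
  have "(\<lambda>k. ((1 / fact k) *\<^sub>R matrix_pow A k) *v v) sums (matrix_exp A *v v)"
    unfolding matrix_exp_def
    by (rule bounded_linear.sums[OF lin summable_sums[OF summable_matrix_exp]])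
  then show ?thesis by (simp add: scaleR_matrix_vector_assoc)
qed

text \<open>The terms of order at least two carry a factor \<open>A\<^sup>2\<close>, and since
\<open>1 / fact (k + 2) \<le> 1 / fact k\<close> what remains of their norms is dominated by the series of
\<open>exp (norm A)\<close>. The estimate is stated for the action on a vector because this is how a
step of the method uses the exponential.\<close>

lemma matrix_exp_second_order:
  fixes A :: "real^'d^'d"
  shows "norm (matrix_exp A *v v - v - A *v v) \<le> (norm A)\<^sup>2 * exp (norm A) * norm v"
proof -
  define f where "f = (\<lambda>k. (1 / fact k) *\<^sub>R (matrix_pow A k *v v))"
  have fs: "f sums (matrix_exp A *v v)"
    unfolding f_def by (rule matrix_exp_vector_sums)
  define b where "b = (\<lambda>k. (norm A)\<^sup>2 * (inverse (fact k) * norm A ^ k) * norm v)"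
  have b: "b sums ((norm A)\<^sup>2 * exp (norm A) * norm v)"
    using exp_converges[of "norm A"] unfolding b_def
    by (intro sums_mult sums_mult2) (simp add: scaleR_conv_of_real)
  have le: "norm (f (k + 2)) \<le> b k" for k
  proof -
    have "norm (f (k + 2)) = norm (matrix_pow A (k + 2) *v v) * inverse (fact (k + 2))"
      by (simp add: f_def divide_inverse)
    also have "\<dots> \<le> (norm A ^ (k + 2) * norm v) * inverse (fact k)"
      by (intro mult_mono norm_matrix_pow_vector_le le_imp_inverse_le fact_mono) auto
    also have "\<dots> = b k"
      by (simp add: b_def power_add power2_eq_square)
    finally show ?thesis .
  qed
  have "matrix_exp A *v v = (\<Sum>k. f (k + 2)) + (\<Sum>k<2. f k)"
    using suminf_split_initial_segment[OF sums_summable[OF fs], of 2] sums_unique[OF fs] by simp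
  moreover have "(\<Sum>k<2. f k) = v + A *v v"
    by (simp add: f_def numeral_2_eq_2)
  ultimately have "matrix_exp A *v v - v - A *v v = (\<Sum>k. f (k + 2))" by simp
  also have "norm \<dots> \<le> (\<Sum>k. b k)"
    by (rule norm_suminf_le[OF le sums_summable[OF b]])
  finally show ?thesis using sums_unique[OF b] by simp
qed

section \<open>Inward-pointing drift and the tamed step\<close>

text \<open>Mean value theorem for \<open>t \<mapsto> \<langle>y - z, F (z + t (y - z))\<rangle>\<close> on the unit interval.\<close>

lemma jacobian_one_sided_lipschitz:
  fixes F :: "real^'d \<Rightarrow> real^'d"
  assumes diff: "\<And>z. F differentiable (at z)"
    and J: "\<And>y z. inner y (jacobian F (at z) *v y) \<le> K * (norm y)\<^sup>2"
  shows "inner (y - z) (F y - F z) \<le> K * (norm (y - z))\<^sup>2"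
proof -
  define v where "v = y - z"
  define \<phi> where "\<phi> = (\<lambda>t. inner v (F (z + t *\<^sub>R v)))"
  have der: "(\<phi> has_derivative (\<lambda>h. h * inner v (jacobian F (at (z + t *\<^sub>R v)) *v v))) (at t within {0..1})" for t
  proof -
    have F': "(F has_derivative (\<lambda>h. jacobian F (at w) *v h)) (at w)" for w
      using diff[of w] by (simp add: jacobian_works)
    have "((\<lambda>t. F (z + t *\<^sub>R v)) has_derivative
        (\<lambda>h. jacobian F (at (z + t *\<^sub>R v)) *v (h *\<^sub>R v))) (at t within {0..1})"
      by (rule has_derivative_compose[OF _ F']) (auto intro!: derivative_eq_intros)
    from has_derivative_inner_right[OF this, of v] show ?thesis
      by (simp add: \<phi>_def matrix_vector_mult_scaleR)
  qed
  obtain t where "\<phi> 1 - \<phi> 0 = (1 - 0) * inner v (jacobian F (at (z + t *\<^sub>R v)) *v v)"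
    using mvt_simple[of 0 1 \<phi>, OF _ der] by auto
  then show ?thesis
    using J[of v "z + t *\<^sub>R v"] by (simp add: \<phi>_def v_def inner_diff_right)
qed

text \<open>The step that makes taming harmless: one-sided Lipschitz continuity does not only bound
\<open>\<langle>y, F y\<rangle>\<close> from above, it forces the drift to point inwards as strongly as it is large,
up to a multiple of \<open>1 + \<parallel>y\<parallel>\<^sup>2\<close>.
The comparison point \<open>w\<close> stays in a fixed ball, where \<open>F\<close> is bounded by compactness, and
its direction turns \<open>- \<langle>w, F y\<rangle>\<close> into \<open>\<parallel>F y\<parallel> / 2\<close>. The constant \<open>1/2\<close> is what the
tamed step below consumes.\<close>

lemma one_sided_lipschitz_coercive:
  fixes F :: "'a::euclidean_space \<Rightarrow> 'a"
  assumes cont: "continuous_on UNIV F"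
    and osl: "\<And>y z. inner (y - z) (F y - F z) \<le> K * (norm (y - z))\<^sup>2"
  obtains C where "0 \<le> C" "\<And>y. inner y (F y) + norm (F y) / 2 \<le> C * (1 + (norm y)\<^sup>2)"
proof -
  have "bounded (F ` cball 0 (1/2))"
    using cont by (intro compact_imp_bounded compact_continuous_image)
      (auto intro: continuous_on_subset)
  then obtain b where "\<forall>v\<in>F ` cball 0 (1/2). norm v \<le> b"
    unfolding bounded_iff by blast
  then have b: "norm (F w) \<le> b" if "norm w \<le> 1/2" for w
    using that by auto
  have b0: "0 \<le> b" using b[of 0] norm_ge_zero[of "F 0"] by (simp del: norm_ge_zero)
  have "inner y (F y) + norm (F y) / 2 \<le> (2 * \<bar>K\<bar> + 2 * b) * (1 + (norm y)\<^sup>2)" for y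
  proof -
    \<comment> \<open>If \<open>F y = 0\<close> then \<open>sgn\<close> gives \<open>w = 0\<close>, which serves as well.\<close>
    define w where "w = - ((1/2) *\<^sub>R sgn (F y))"
    have w: "norm w \<le> 1/2" by (simp add: w_def norm_sgn)
    have "inner w (F y) = - (norm (F y) / 2)"
      by (cases "F y = 0")
        (simp_all add: w_def sgn_div_norm power2_norm_eq_inner[symmetric] power2_eq_square)
    then have "inner y (F y) + norm (F y) / 2 = inner (y - w) (F y - F w) + inner (y - w) (F w)"
      by (simp add: inner_diff_left inner_diff_right)
    also have "\<dots> \<le> K * (norm (y - w))\<^sup>2 + norm (y - w) * norm (F w)"
      by (intro add_mono osl norm_cauchy_schwarz)
    also have "\<dots> \<le> \<bar>K\<bar> * (norm y + 1)\<^sup>2 + (norm y + 1) * b"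
    proof (intro add_mono mult_mono b w power_mono)
      show "norm (y - w) \<le> norm y + 1" using norm_triangle_ineq4[of y w] w by simp
      then show "norm (y - w) \<le> norm y + 1" .
    qed auto
    also have "\<dots> \<le> \<bar>K\<bar> * (2 * (1 + (norm y)\<^sup>2)) + (2 * (1 + (norm y)\<^sup>2)) * b"
    proof (intro add_mono mult_mono)
      have "0 \<le> (norm y - 1)\<^sup>2" by simp
      then have amgm: "2 * norm y \<le> 1 + (norm y)\<^sup>2"
        unfolding power2_diff by simp
      then show "(norm y + 1)\<^sup>2 \<le> 2 * (1 + (norm y)\<^sup>2)"
        unfolding power2_sum by simp
      show "norm y + 1 \<le> 2 * (1 + (norm y)\<^sup>2)"
        using amgm zero_le_power2[of "norm y"] by argo
    qed (use b0 in auto)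
    finally show ?thesis by (simp add: algebra_simps)
  qed
  with b0 show thesis by (intro that[of "2 * \<bar>K\<bar> + 2 * b"]) auto
qed

text \<open>With \<open>h = \<Delta> a\<close> and \<open>h \<parallel>f\<parallel> \<le> 1\<close>, the square \<open>h\<^sup>2 \<parallel>f\<parallel>\<^sup>2\<close> is at most \<open>h \<parallel>f\<parallel>\<close>, and
\<open>2 h \<langle>y, f\<rangle> + h \<parallel>f\<parallel>\<close> is \<open>2 h\<close> times the quantity that the coercivity bounds.\<close>

lemma tamed_drift_step:
  fixes y f :: "'a::real_inner"
  assumes coer: "inner y f + norm f / 2 \<le> C * (1 + (norm y)\<^sup>2)"
    and "0 \<le> \<Delta>" "0 \<le> a" "a \<le> 1" "0 \<le> C"
    and tame: "norm (a *\<^sub>R f) * \<Delta> \<le> 1"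
  shows "(norm (y + \<Delta> *\<^sub>R (a *\<^sub>R f)))\<^sup>2 \<le> (norm y)\<^sup>2 + 2 * C * \<Delta> * (1 + (norm y)\<^sup>2)"
proof -
  define h where "h = \<Delta> * a"
  have h: "0 \<le> h" "h \<le> \<Delta>" "h * norm f \<le> 1"
    using assms by (auto simp: h_def mult_left_le mult_ac)
  have "(norm (y + h *\<^sub>R f))\<^sup>2 = (norm y)\<^sup>2 + 2 * h * inner y f + (h * norm f) * (h * norm f)"
    using dot_norm[of y "h *\<^sub>R f"] h(1) by (simp add: power2_eq_square field_simps)
  also have "(h * norm f) * (h * norm f) \<le> h * norm f"
    using h by (intro mult_left_le) auto
  finally have "(norm (y + h *\<^sub>R f))\<^sup>2 \<le> (norm y)\<^sup>2 + 2 * h * (inner y f + norm f / 2)"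
    by (simp add: algebra_simps)
  also have "\<dots> \<le> (norm y)\<^sup>2 + 2 * h * (C * (1 + (norm y)\<^sup>2))"
    using h coer by (intro add_left_mono mult_left_mono) auto
  also have "\<dots> \<le> (norm y)\<^sup>2 + 2 * \<Delta> * (C * (1 + (norm y)\<^sup>2))"
    using h assms by (intro add_left_mono mult_right_mono) auto
  finally show ?thesis by (simp add: h_def mult_ac)
qed

section \<open>Pathwise expansion of one step\<close>

text \<open>A second-order Taylor bound with the sign of \<open>a\<close> unrestricted; the linear term has to be kept
exactly, since only its mean vanishes.\<close>

lemma power_one_plus_linear_error:
  fixes a :: real
  shows "\<bar>(1 + a) ^ k - 1 - real k * a\<bar> \<le> (real k)\<^sup>2 * a\<^sup>2 * (1 + \<bar>a\<bar>) ^ k"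
proof (induction k)
  case (Suc k)
  have "(1 + a) ^ Suc k - 1 - real (Suc k) * a = (1 + a) * ((1 + a) ^ k - 1 - real k * a) + real k * a\<^sup>2"
    by (simp add: algebra_simps power2_eq_square)
  also have "\<bar>\<dots>\<bar> \<le> \<bar>1 + a\<bar> * \<bar>(1 + a) ^ k - 1 - real k * a\<bar> + real k * a\<^sup>2"
    by (rule order_trans[OF abs_triangle_ineq]) (simp add: abs_mult)
  also have "\<dots> \<le> (1 + \<bar>a\<bar>) * ((real k)\<^sup>2 * a\<^sup>2 * (1 + \<bar>a\<bar>) ^ k) + real k * a\<^sup>2 * (1 + \<bar>a\<bar>) ^ Suc k"
  proof (rule add_mono)
    show "\<bar>1 + a\<bar> * \<bar>(1 + a) ^ k - 1 - real k * a\<bar> \<le> (1 + \<bar>a\<bar>) * ((real k)\<^sup>2 * a\<^sup>2 * (1 + \<bar>a\<bar>) ^ k)"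
      using Suc.IH by (intro mult_mono) auto
    have "1 \<le> (1 + \<bar>a\<bar>) ^ Suc k" by (rule one_le_power) simp
    from mult_left_mono[OF this, of "real k * a\<^sup>2"]
    show "real k * a\<^sup>2 \<le> real k * a\<^sup>2 * (1 + \<bar>a\<bar>) ^ Suc k" by simp
  qed
  also have "\<dots> = ((real k)\<^sup>2 + real k) * a\<^sup>2 * (1 + \<bar>a\<bar>) ^ Suc k"
    by (simp add: algebra_simps)
  also have "\<dots> \<le> (real (Suc k))\<^sup>2 * a\<^sup>2 * (1 + \<bar>a\<bar>) ^ Suc k"
    by (intro mult_right_mono) (auto simp: power2_eq_square algebra_simps)
  finally show ?case .
qed simp

text \<open>Passage from an expansion of the iterate to one of its Lyapunov function. In
\<open>\<parallel>u + L + R\<parallel>\<^sup>2\<close> the only contribution of order \<open>\<tau>\<close> is \<open>2 \<langle>u, L\<rangle>\<close>, which appears in the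
conclusion unestimated so that its mean can be taken later. All other terms, including the
quadratic ones created by the \<open>k\<close>-th power, are of order \<open>\<tau>\<^sup>2\<close> times an exponential:
surplus powers of \<open>\<tau>\<close> are absorbed through \<open>\<tau> \<le> exp \<tau>\<close>. All constants are uniform in
\<open>y\<close> because every quantity is measured relative to \<open>q = 1 + \<parallel>y\<parallel>\<^sup>2\<close>.\<close>

lemma lyapunov_power_expansion:
  fixes y u L R :: "'a::real_inner" and \<tau> C\<^sub>0 C\<^sub>1 \<kappa> \<mu> :: real and k :: nat
  defines "q \<equiv> 1 + (norm y)\<^sup>2"
  defines "C \<equiv> C\<^sub>0 + 4 * C\<^sub>1 + 2 * \<kappa>\<^sup>2 + 2 * C\<^sub>1\<^sup>2"
  defines "c \<equiv> 2 * \<mu> + 2"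
  defines "D \<equiv> 4 * \<kappa> + C"
  assumes nonneg: "0 \<le> \<tau>" "0 \<le> C\<^sub>0" "0 \<le> C\<^sub>1" "0 \<le> \<kappa>" "0 \<le> \<mu>"
    and u2: "(norm u)\<^sup>2 \<le> (norm y)\<^sup>2 + C\<^sub>0 * \<tau>\<^sup>2 * q"
    and u: "norm u \<le> 2 * sqrt q"
    and L: "norm L \<le> \<kappa> * \<tau> * sqrt q"
    and R: "norm R \<le> C\<^sub>1 * \<tau>\<^sup>2 * exp (\<mu> * \<tau>) * sqrt q"
  shows "(1 + (norm (u + L + R))\<^sup>2) ^ k \<le> q ^ k * (1 + real k * (2 * inner u L / q)
      + (real k * C + (real k)\<^sup>2 * D\<^sup>2 * (1 + D) ^ k) * \<tau>\<^sup>2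
          * exp ((2 * (c + 1) + real k * (c + 2)) * \<tau>))"
proof -
  have q: "1 \<le> q" by (simp add: q_def)
  have sq: "sqrt q * sqrt q = q" using q by simp
  define l where "l = 2 * inner u L / q"
  define E where "E = exp (c * \<tau>)"
  have C: "0 \<le> C" "0 \<le> D" "0 \<le> c" using nonneg by (auto simp: C_def c_def D_def)
  have \<tau>E: "\<tau> \<le> exp \<tau>" using exp_ge_add_one_self[of \<tau>] by linarith
  have \<tau>2: "\<tau>\<^sup>2 \<le> exp (2 * \<tau>)"
    using power_mono[OF \<tau>E nonneg(1), of 2] by (simp add: exp_double)
  have l: "\<bar>l\<bar> \<le> 4 * \<kappa> * \<tau>"
  proof -
    have "\<bar>inner u L\<bar> \<le> (2 * sqrt q) * (\<kappa> * \<tau> * sqrt q)"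
      by (intro order_trans[OF Cauchy_Schwarz_ineq2] mult_mono u L) (use q in auto)
    also have "\<dots> = 2 * \<kappa> * \<tau> * q" using sq by (simp add: algebra_simps)
    finally have "2 * \<bar>inner u L\<bar> \<le> (4 * \<kappa> * \<tau>) * q" by simp
    then show ?thesis using q by (simp add: l_def abs_mult divide_le_eq)
  qed
  have E1: "1 \<le> E" "exp (\<mu> * \<tau>) \<le> E"
    using nonneg by (auto simp: E_def c_def intro!: mult_right_mono)
  have uR: "inner u R \<le> 2 * C\<^sub>1 * \<tau>\<^sup>2 * E * q"
  proof -
    have "inner u R \<le> (2 * sqrt q) * (C\<^sub>1 * \<tau>\<^sup>2 * E * sqrt q)"
    proof (intro order_trans[OF norm_cauchy_schwarz] mult_mono u)
      show "norm R \<le> C\<^sub>1 * \<tau>\<^sup>2 * E * sqrt q"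
        by (rule order_trans[OF R]) (use q nonneg E1 in \<open>auto intro!: mult_right_mono mult_left_mono\<close>)
    qed (use q in auto)
    also have "\<dots> = 2 * C\<^sub>1 * \<tau>\<^sup>2 * E * q" using sq by (simp add: algebra_simps)
    finally show ?thesis .
  qed
  have L2: "(norm L)\<^sup>2 \<le> \<kappa>\<^sup>2 * \<tau>\<^sup>2 * E * q"
  proof -
    have "(norm L)\<^sup>2 \<le> (\<kappa> * \<tau> * sqrt q)\<^sup>2" by (intro power_mono L) auto
    also have "\<dots> = \<kappa>\<^sup>2 * \<tau>\<^sup>2 * 1 * q" using q by (simp add: power_mult_distrib)
    also have "\<dots> \<le> \<kappa>\<^sup>2 * \<tau>\<^sup>2 * E * q" using E1 q by (intro mult_right_mono mult_left_mono) auto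
    finally show ?thesis .
  qed
  have R2: "(norm R)\<^sup>2 \<le> C\<^sub>1\<^sup>2 * \<tau>\<^sup>2 * E * q"
  proof -
    have "(norm R)\<^sup>2 \<le> (C\<^sub>1 * \<tau>\<^sup>2 * exp (\<mu> * \<tau>) * sqrt q)\<^sup>2" by (intro power_mono R) auto
    also have "\<dots> = (C\<^sub>1\<^sup>2 * \<tau>\<^sup>2) * (\<tau>\<^sup>2 * exp (2 * \<mu> * \<tau>)) * q"
      using q by (simp add: power_mult_distrib power2_eq_square[of "exp _"] mult_exp_exp
          algebra_simps power2_eq_square[of "\<tau>\<^sup>2"])
    also have "\<dots> \<le> (C\<^sub>1\<^sup>2 * \<tau>\<^sup>2) * (exp (2 * \<tau>) * exp (2 * \<mu> * \<tau>)) * q"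
      using q \<tau>2 by (intro mult_right_mono mult_left_mono) auto
    also have "\<dots> = C\<^sub>1\<^sup>2 * \<tau>\<^sup>2 * E * q"
      by (simp add: E_def c_def mult_exp_exp algebra_simps)
    finally show ?thesis .
  qed
  define a where "a = l + C * \<tau>\<^sup>2 * E"
  have "(norm (u + L + R))\<^sup>2 = (norm u)\<^sup>2 + 2 * inner u L + 2 * inner u R + (norm (L + R))\<^sup>2"
    by (simp add: power2_norm_eq_inner inner_add_left inner_add_right inner_commute)
  also have "(norm (L + R))\<^sup>2 \<le> 2 * (norm L)\<^sup>2 + 2 * (norm R)\<^sup>2"
    using zero_le_power2[of "norm (L - R)"]
    unfolding power2_norm_eq_inner inner_add_left inner_add_right inner_diff_left inner_diff_right
    by (simp add: inner_commute)
  finally have "1 + (norm (u + L + R))\<^sup>2 \<le> 1 + ((norm y)\<^sup>2 + C\<^sub>0 * \<tau>\<^sup>2 * q) + 2 * inner u L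
      + 2 * (2 * C\<^sub>1 * \<tau>\<^sup>2 * E * q) + (2 * (\<kappa>\<^sup>2 * \<tau>\<^sup>2 * E * q) + 2 * (C\<^sub>1\<^sup>2 * \<tau>\<^sup>2 * E * q))"
    using u2 uR L2 R2 by linarith
  also have "C\<^sub>0 * \<tau>\<^sup>2 * q \<le> C\<^sub>0 * \<tau>\<^sup>2 * E * q"
    using mult_left_mono[OF E1(1), of "C\<^sub>0 * \<tau>\<^sup>2 * q"] q nonneg by (simp add: mult_ac)
  also have "2 * inner u L = l * q" using q by (simp add: l_def)
  finally have main: "1 + (norm (u + L + R))\<^sup>2 \<le> q * (1 + a)"
    by (simp add: a_def C_def q_def algebra_simps)
  define G where "G = exp ((c + 1) * \<tau>)"
  have G: "1 \<le> G" "E \<le> G" "\<tau> * E \<le> G"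
  proof -
    show "1 \<le> G" "E \<le> G" using C nonneg by (auto simp: G_def E_def algebra_simps)
    have "\<tau> * E \<le> exp \<tau> * E" using \<tau>E E1 by (intro mult_right_mono) auto
    then show "\<tau> * E \<le> G" by (simp add: G_def E_def mult_exp_exp algebra_simps)
  qed
  have a: "\<bar>a\<bar> \<le> D * (\<tau> * G)"
  proof -
    have "\<bar>a\<bar> \<le> \<bar>l\<bar> + \<bar>C * \<tau>\<^sup>2 * E\<bar>" unfolding a_def by (rule abs_triangle_ineq)
    also have "\<bar>C * \<tau>\<^sup>2 * E\<bar> = C * \<tau> * (\<tau> * E)"
      using C E1 nonneg by (simp add: abs_mult power2_eq_square)
    also have "\<bar>l\<bar> + C * \<tau> * (\<tau> * E) \<le> 4 * \<kappa> * \<tau> * G + C * \<tau> * G"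
    proof (intro add_mono mult_left_mono G)
      have "4 * \<kappa> * \<tau> * 1 \<le> 4 * \<kappa> * \<tau> * G" using G nonneg by (intro mult_left_mono) auto
      then show "\<bar>l\<bar> \<le> 4 * \<kappa> * \<tau> * G" using l by simp
    qed (use C nonneg in auto)
    finally show ?thesis by (simp add: D_def algebra_simps)
  qed
  have a2: "a\<^sup>2 \<le> D\<^sup>2 * \<tau>\<^sup>2 * exp (2 * (c + 1) * \<tau>)"
  proof -
    have "a\<^sup>2 \<le> (D * (\<tau> * G))\<^sup>2" using power_mono[OF a, of 2] by simp
    also have "\<dots> = D\<^sup>2 * \<tau>\<^sup>2 * exp (2 * (c + 1) * \<tau>)"
      by (simp add: power_mult_distrib G_def power2_eq_square[of "exp _"] mult_exp_exp algebra_simps)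
    finally show ?thesis .
  qed
  have a1: "(1 + \<bar>a\<bar>) ^ k \<le> (1 + D) ^ k * exp (real k * (c + 2) * \<tau>)"
  proof -
    have "\<tau> * G \<le> exp \<tau> * G" using \<tau>E G by (intro mult_right_mono) auto
    also have "\<dots> = exp ((c + 2) * \<tau>)" by (simp add: G_def mult_exp_exp algebra_simps)
    finally have "D * (\<tau> * G) \<le> D * exp ((c + 2) * \<tau>)" using C by (intro mult_left_mono) auto
    moreover have "1 \<le> exp ((c + 2) * \<tau>)" using C nonneg by auto
    ultimately have "1 + \<bar>a\<bar> \<le> (1 + D) * exp ((c + 2) * \<tau>)"
      using a unfolding distrib_right[of 1 D] mult_1 by linarith
    then have "(1 + \<bar>a\<bar>) ^ k \<le> ((1 + D) * exp ((c + 2) * \<tau>)) ^ k" by (intro power_mono) auto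
    then show ?thesis
      by (simp add: power_mult_distrib exp_of_nat_mult[symmetric] mult.assoc)
  qed
  define H where "H = exp ((2 * (c + 1) + real k * (c + 2)) * \<tau>)"
  have "(1 + (norm (u + L + R))\<^sup>2) ^ k \<le> (q * (1 + a)) ^ k"
    by (intro power_mono main) (simp add: add_nonneg_nonneg)
  also have "\<dots> = q ^ k * (1 + a) ^ k" by (simp add: power_mult_distrib)
  also have "\<dots> \<le> q ^ k * (1 + real k * l + (real k * C + (real k)\<^sup>2 * D\<^sup>2 * (1 + D) ^ k) * \<tau>\<^sup>2 * H)"
  proof (intro mult_left_mono)
    have "(1 + a) ^ k \<le> 1 + real k * a + (real k)\<^sup>2 * a\<^sup>2 * (1 + \<bar>a\<bar>) ^ k"
      using power_one_plus_linear_error[of a k] by linarith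
    also have "(real k)\<^sup>2 * a\<^sup>2 * (1 + \<bar>a\<bar>) ^ k \<le> (real k)\<^sup>2 * (D\<^sup>2 * \<tau>\<^sup>2 * exp (2 * (c + 1) * \<tau>))
        * ((1 + D) ^ k * exp (real k * (c + 2) * \<tau>))"
      by (intro mult_mono a1 a2) auto
    also have "\<dots> = (real k)\<^sup>2 * D\<^sup>2 * (1 + D) ^ k * \<tau>\<^sup>2 * H"
      unfolding H_def distrib_right exp_add by (simp only: mult_ac)
    also have "real k * a = real k * l + real k * C * \<tau>\<^sup>2 * E"
      by (simp add: a_def algebra_simps)
    also have "real k * C * \<tau>\<^sup>2 * E \<le> real k * C * \<tau>\<^sup>2 * H"
    proof (intro mult_left_mono)
      have "c * \<tau> \<le> (2 * (c + 1) + real k * (c + 2)) * \<tau>"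
        using C nonneg by (intro mult_right_mono) (auto intro!: add_increasing2)
      then show "E \<le> H" by (simp add: E_def H_def)
    qed (use C in auto)
    finally show "(1 + a) ^ k \<le> 1 + real k * l
        + (real k * C + (real k)\<^sup>2 * D\<^sup>2 * (1 + D) ^ k) * \<tau>\<^sup>2 * H"
      by (simp add: distrib_right)
  qed (use q in auto)
  finally show ?thesis unfolding l_def H_def .
qed

text \<open>First-order expansion of one step in the size \<open>\<tau>\<close> of its noise. As \<open>\<Delta> \<le> \<tau>\<^sup>2\<close>, the drift
parts of the exponent and of its argument already belong to the remainder; of the product of
exponential and argument only \<open>u\<close> and the terms linear in \<open>\<xi>\<close> survive. The scale \<open>w\<close>
stands for \<open>sqrt (1 + \<parallel>y\<parallel>\<^sup>2)\<close>.\<close>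

lemma gbm_step_expansion:
  fixes A :: "real^'d^'d" and B :: "'m::finite \<Rightarrow> real^'d^'d" and g :: "'m \<Rightarrow> real^'d"
    and u :: "real^'d" and \<xi> :: "'m \<Rightarrow> real" and \<Delta> T \<gamma> w :: real
  defines "\<beta> \<equiv> norm A + (\<Sum>i\<in>UNIV. norm (B i))"
  defines "\<tau> \<equiv> sqrt \<Delta> + (\<Sum>i\<in>UNIV. \<bar>\<xi> i\<bar>)"
  defines "\<mu> \<equiv> \<beta> * (1 + sqrt T)" and "\<nu> \<equiv> \<gamma> * (1 + \<beta> * sqrt T)"
  defines "L \<equiv> (\<Sum>i\<in>UNIV. \<xi> i *\<^sub>R (g i + B i *v u))"
  defines "X \<equiv> matrix_exp (\<Delta> *\<^sub>R A + (\<Sum>i\<in>UNIV. \<xi> i *\<^sub>R B i))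
      *v (u - \<Delta> *\<^sub>R (\<Sum>i\<in>UNIV. B i *v g i) + (\<Sum>i\<in>UNIV. \<xi> i *\<^sub>R g i))"
  assumes \<Delta>: "0 \<le> \<Delta>" "\<Delta> \<le> T" and w: "0 \<le> w" and \<gamma>: "0 \<le> \<gamma>"
    and u: "norm u \<le> 2 * w" and g: "\<And>i. norm (g i) \<le> \<gamma> * w"
  shows "norm L \<le> (\<gamma> + 2 * \<beta>) * \<tau> * w"
    and "norm (X - u - L)
      \<le> (\<beta> * \<gamma> + 2 * \<beta> + \<mu> * \<nu> + \<mu>\<^sup>2 * (2 + \<nu>)) * \<tau>\<^sup>2 * exp ((\<mu> + 1) * \<tau>) * w"
proof -
  define s where "s = (\<Sum>i\<in>UNIV. \<bar>\<xi> i\<bar>)"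
  have s: "0 \<le> s" "s \<le> \<tau>" and \<tau>: "0 \<le> \<tau>"
    using \<Delta> by (auto simp: s_def \<tau>_def intro!: sum_nonneg add_nonneg_nonneg)
  \<comment> \<open>The first bound turns drift terms into second-order terms; the second one, linear in \<open>\<tau>\<close>,
    uses the finite horizon and bounds the exponent.\<close>
  have \<Delta>\<tau>: "\<Delta> \<le> \<tau>\<^sup>2" "\<Delta> \<le> sqrt T * \<tau>"
  proof -
    have r: "sqrt \<Delta> \<le> \<tau>" using s(1) by (simp add: \<tau>_def s_def)
    have "\<Delta> = (sqrt \<Delta>)\<^sup>2" using \<Delta> by simp
    also have "\<dots> \<le> \<tau>\<^sup>2" by (intro power_mono r) (use \<Delta> in auto)
    finally show "\<Delta> \<le> \<tau>\<^sup>2" .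
    have "\<Delta> = sqrt \<Delta> * sqrt \<Delta>" using \<Delta> by simp
    also have "\<dots> \<le> sqrt T * \<tau>" by (intro mult_mono r) (use \<Delta> in auto)
    finally show "\<Delta> \<le> sqrt T * \<tau>" .
  qed
  have \<beta>: "0 \<le> \<beta>" "norm A \<le> \<beta>" "(\<Sum>i\<in>UNIV. norm (B i)) \<le> \<beta>" "\<And>i. norm (B i) \<le> \<beta>"
  proof -
    have "norm (B i) \<le> (\<Sum>i\<in>UNIV. norm (B i))" for i by (rule member_le_sum) auto
    then show "norm (B i) \<le> \<beta>" for i by (simp add: \<beta>_def add_increasing)
  qed (auto simp: \<beta>_def intro!: add_nonneg_nonneg sum_nonneg)
  have T: "0 \<le> T" using \<Delta> by simp
  have \<mu>: "0 \<le> \<mu>" "0 \<le> \<nu>" using \<beta> \<gamma> T by (auto simp: \<mu>_def \<nu>_def)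
  have weighted: "norm (\<Sum>i\<in>UNIV. \<xi> i *\<^sub>R f i) \<le> s * K" if "\<And>i. norm (f i) \<le> K"
    for f :: "'m \<Rightarrow> 'v::real_normed_vector" and K
  proof -
    have "norm (\<Sum>i\<in>UNIV. \<xi> i *\<^sub>R f i) \<le> (\<Sum>i\<in>UNIV. \<bar>\<xi> i\<bar> * K)"
      by (rule sum_norm_le) (use that in \<open>auto intro!: mult_left_mono\<close>)
    then show ?thesis by (simp add: s_def sum_distrib_right)
  qed
  have Bu: "norm (B i *v v) \<le> \<beta> * norm v" for i v
    by (rule order_trans[OF norm_matrix_vector_le mult_right_mono[OF \<beta>(4)]]) simp
  have "norm (g i + B i *v u) \<le> \<gamma> * w + \<beta> * (2 * w)" for i
    by (intro norm_triangle_mono g order_trans[OF Bu mult_left_mono[OF u]] \<beta>)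
  from weighted[OF this] have "norm L \<le> s * (\<gamma> * w + \<beta> * (2 * w))" unfolding L_def .
  also have "\<dots> \<le> \<tau> * (\<gamma> * w + \<beta> * (2 * w))"
    using s \<beta> \<gamma> w by (intro mult_right_mono) auto
  finally show "norm L \<le> (\<gamma> + 2 * \<beta>) * \<tau> * w" by (simp add: algebra_simps)
  define M where "M = \<Delta> *\<^sub>R A + (\<Sum>i\<in>UNIV. \<xi> i *\<^sub>R B i)"
  define e where "e = \<Delta> *\<^sub>R (\<Sum>i\<in>UNIV. B i *v g i)"
  define G where "G = (\<Sum>i\<in>UNIV. \<xi> i *\<^sub>R g i)"
  define v where "v = u - e + G"
  have v_eq: "v = u + (G - e)" by (simp add: v_def)
  have M: "norm M \<le> \<mu> * \<tau>"
  proof -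
    have "norm M \<le> \<Delta> * norm A + s * \<beta>"
      unfolding M_def using \<Delta> by (intro norm_triangle_mono weighted \<beta>) auto
    also have "\<dots> \<le> (sqrt T * \<tau>) * \<beta> + \<tau> * \<beta>"
      by (intro add_mono mult_mono \<Delta>\<tau> \<beta> s) (use T \<tau> \<beta> in auto)
    finally show ?thesis by (simp add: \<mu>_def algebra_simps)
  qed
  have e: "norm e \<le> \<Delta> * (\<beta> * \<gamma> * w)"
  proof -
    have "norm (\<Sum>i\<in>UNIV. B i *v g i) \<le> (\<Sum>i\<in>UNIV. norm (B i) * (\<gamma> * w))"
      by (rule sum_norm_le) (blast intro: order_trans[OF norm_matrix_vector_le mult_left_mono[OF g]] norm_ge_zero)
    also have "\<dots> = (\<Sum>i\<in>UNIV. norm (B i)) * (\<gamma> * w)" by (simp add: sum_distrib_right)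
    also have "\<dots> \<le> \<beta> * (\<gamma> * w)" using \<beta> \<gamma> w by (intro mult_right_mono) auto
    finally show ?thesis using \<Delta> by (simp add: e_def mult_left_mono mult.assoc)
  qed
  have e2: "norm e \<le> \<beta> * \<gamma> * \<tau>\<^sup>2 * w"
    using order_trans[OF e mult_right_mono[OF \<Delta>\<tau>(1), of "\<beta> * \<gamma> * w"]] \<beta> \<gamma> w by (simp add: mult_ac)
  have Ge: "norm (G - e) \<le> \<nu> * \<tau> * w"
  proof -
    have "norm (G - e) \<le> s * (\<gamma> * w) + \<Delta> * (\<beta> * \<gamma> * w)"
      unfolding G_def using norm_triangle_ineq4 weighted[OF g] e by (meson add_mono order_trans)
    also have "\<dots> \<le> \<tau> * (\<gamma> * w) + (sqrt T * \<tau>) * (\<beta> * \<gamma> * w)"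
      using \<beta> \<gamma> w by (intro add_mono mult_right_mono s \<Delta>\<tau>) auto
    finally show ?thesis by (simp add: \<nu>_def algebra_simps)
  qed
  have E: "\<tau> \<le> exp \<tau>" "1 \<le> exp \<tau>" using exp_ge_add_one_self[of \<tau>] \<tau> by linarith+
  have v: "norm v \<le> (2 + \<nu>) * exp \<tau> * w"
  proof -
    have "norm v \<le> 2 * w + \<nu> * \<tau> * w" unfolding v_eq by (intro norm_triangle_mono u Ge)
    also have "\<dots> \<le> 2 * exp \<tau> * w + \<nu> * exp \<tau> * w"
      using E \<mu> w by (intro add_mono mult_right_mono mult_left_mono) auto
    finally show ?thesis by (simp add: algebra_simps)
  qed
  define F where "F = exp ((\<mu> + 1) * \<tau>)"
  have F_split: "F = exp (\<mu> * \<tau>) * exp \<tau>"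
    by (simp add: F_def distrib_right exp_add)
  have F: "1 \<le> F" using \<mu> \<tau> by (simp add: F_def)
  have rem: "norm (X - v - M *v v) \<le> \<mu>\<^sup>2 * (2 + \<nu>) * \<tau>\<^sup>2 * F * w"
  proof -
    have "X = matrix_exp M *v v" by (simp add: X_def M_def v_def e_def G_def)
    then have "norm (X - v - M *v v) \<le> (norm M)\<^sup>2 * exp (norm M) * norm v"
      by (simp add: matrix_exp_second_order)
    also have "\<dots> \<le> (\<mu> * \<tau>)\<^sup>2 * exp (\<mu> * \<tau>) * ((2 + \<nu>) * exp \<tau> * w)"
      by (intro mult_mono power_mono M v) (use M in auto)
    also have "\<dots> = \<mu>\<^sup>2 * (2 + \<nu>) * \<tau>\<^sup>2 * F * w"
      using F_split by (simp add: power_mult_distrib mult_ac)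
    finally show ?thesis .
  qed
  have MGe: "norm (M *v (G - e)) \<le> \<mu> * \<nu> * \<tau>\<^sup>2 * w"
  proof -
    have "norm (M *v (G - e)) \<le> (\<mu> * \<tau>) * (\<nu> * \<tau> * w)"
      by (intro order_trans[OF norm_matrix_vector_le] mult_mono M Ge) (use \<mu> \<tau> in auto)
    then show ?thesis by (simp add: power2_eq_square mult_ac)
  qed
  have Au: "norm (\<Delta> *\<^sub>R (A *v u)) \<le> 2 * \<beta> * \<tau>\<^sup>2 * w"
  proof -
    have "norm (\<Delta> *\<^sub>R (A *v u)) \<le> \<Delta> * (norm A * norm u)"
      using \<Delta> norm_matrix_vector_le[of A u] by (simp add: mult_left_mono)
    also have "\<dots> \<le> \<tau>\<^sup>2 * (\<beta> * (2 * w))"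
      using \<Delta> \<beta> by (intro mult_mono \<Delta>\<tau> \<beta> u) auto
    finally show ?thesis by (simp add: mult_ac)
  qed
  have sum_mv: "(\<Sum>i\<in>UNIV. \<xi> i *\<^sub>R B i) *v u = (\<Sum>i\<in>UNIV. \<xi> i *\<^sub>R (B i *v u))"
  proof -
    have "linear (\<lambda>N :: real^'d^'d. N *v u)"
      by (rule linearI) (auto simp: matrix_vector_mult_add_rdistrib scaleR_matrix_vector_assoc)
    from linear_sum[OF this, of "\<lambda>i. \<xi> i *\<^sub>R B i" UNIV]
    show ?thesis by (simp add: scaleR_matrix_vector_assoc)
  qed
  have Mv: "M *v v = \<Delta> *\<^sub>R (A *v u) + (\<Sum>i\<in>UNIV. \<xi> i *\<^sub>R (B i *v u)) + M *v (G - e)"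
  proof -
    have "M *v v = M *v u + M *v (G - e)"
      unfolding v_eq by (rule matrix_vector_right_distrib)
    then show ?thesis
      by (simp only: M_def matrix_vector_mult_add_rdistrib sum_mv scaleR_matrix_vector_assoc)
  qed
  have L_eq: "L = G + (\<Sum>i\<in>UNIV. \<xi> i *\<^sub>R (B i *v u))"
    by (simp add: L_def G_def scaleR_add_right sum.distrib)
  have "X - u - (G + S) = (X - v - Q) + D + P - e" if "Q = D + S + P" for Q D S P :: "real^'d"
    using that by (simp add: v_eq algebra_simps)
  from this[OF Mv]
  have "X - u - L = (X - v - M *v v) + \<Delta> *\<^sub>R (A *v u) + M *v (G - e) - e"
    unfolding L_eq .
  then have "norm (X - u - L) \<le> norm (X - v - M *v v) + norm (\<Delta> *\<^sub>R (A *v u))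
      + norm (M *v (G - e)) + norm e"
    by (smt (verit) norm_triangle_ineq norm_triangle_ineq4)
  also have "\<dots> \<le> \<mu>\<^sup>2 * (2 + \<nu>) * \<tau>\<^sup>2 * F * w + 2 * \<beta> * \<tau>\<^sup>2 * w + \<mu> * \<nu> * \<tau>\<^sup>2 * w
      + \<beta> * \<gamma> * \<tau>\<^sup>2 * w"
    by (intro add_mono rem Au MGe e2)
  also have "\<dots> = \<mu>\<^sup>2 * (2 + \<nu>) * \<tau>\<^sup>2 * F * w + (2 * \<beta> + \<mu> * \<nu> + \<beta> * \<gamma>) * \<tau>\<^sup>2 * 1 * w"
    by (simp add: algebra_simps)
  also have "\<dots> \<le> \<mu>\<^sup>2 * (2 + \<nu>) * \<tau>\<^sup>2 * F * w + (2 * \<beta> + \<mu> * \<nu> + \<beta> * \<gamma>) * \<tau>\<^sup>2 * F * w"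
    using F \<beta> \<gamma> \<mu> w by (intro add_left_mono mult_right_mono mult_left_mono) auto
  also have "\<dots> = (\<beta> * \<gamma> + 2 * \<beta> + \<mu> * \<nu> + \<mu>\<^sup>2 * (2 + \<nu>)) * \<tau>\<^sup>2 * F * w"
    by (simp add: algebra_simps)
  finally show "norm (X - u - L)
      \<le> (\<beta> * \<gamma> + 2 * \<beta> + \<mu> * \<nu> + \<mu>\<^sup>2 * (2 + \<nu>)) * \<tau>\<^sup>2 * exp ((\<mu> + 1) * \<tau>) * w"
    unfolding F_def .
qed

text \<open>One step of the method, seen pathwise: the increments are a fixed vector \<open>\<xi>\<close> and
\<open>a\<close> is the value of the taming function. The constants are chosen before step size, state
and increments, which is what makes the final bound uniform in \<open>N\<close>.\<close>

lemma tamed_step_lyapunov: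
  fixes A :: "real^'d^'d" and B :: "'m::finite \<Rightarrow> real^'d^'d"
    and F :: "real^'d \<Rightarrow> real^'d" and g :: "'m \<Rightarrow> real^'d \<Rightarrow> real^'d"
    and C \<gamma> T :: real and k :: nat
  assumes C: "0 \<le> C" "\<And>y. inner y (F y) + norm (F y) / 2 \<le> C * (1 + (norm y)\<^sup>2)"
    and \<gamma>: "0 \<le> \<gamma>" "\<And>i y. norm (g i y) \<le> \<gamma> * sqrt (1 + (norm y)\<^sup>2)"
    and T: "0 \<le> T"
  obtains K \<kappa> where "0 \<le> K" "0 \<le> \<kappa>"
    "\<And>\<Delta> a y \<xi> u X \<tau>. \<lbrakk>0 \<le> \<Delta>; \<Delta> \<le> T; 0 \<le> a; a \<le> 1; norm (a *\<^sub>R F y) * \<Delta> \<le> 1;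
        u = y + \<Delta> *\<^sub>R (a *\<^sub>R F y);
        X = matrix_exp (\<Delta> *\<^sub>R A + (\<Sum>i\<in>UNIV. \<xi> i *\<^sub>R B i))
          *v (u - \<Delta> *\<^sub>R (\<Sum>i\<in>UNIV. B i *v g i y) + (\<Sum>i\<in>UNIV. \<xi> i *\<^sub>R g i y));
        \<tau> = sqrt \<Delta> + (\<Sum>i\<in>UNIV. \<bar>\<xi> i\<bar>)\<rbrakk> \<Longrightarrow>
      (1 + (norm X)\<^sup>2) ^ k \<le> (1 + (norm y)\<^sup>2) ^ k * (1
        + (\<Sum>i\<in>UNIV. \<xi> i * (real k * (2 * inner u (g i y + B i *v u) / (1 + (norm y)\<^sup>2))))
        + K * \<tau>\<^sup>2 * exp (\<kappa> * \<tau>))"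
    "\<And>\<Delta> a y i u. \<lbrakk>0 \<le> \<Delta>; norm (a *\<^sub>R F y) * \<Delta> \<le> 1; u = y + \<Delta> *\<^sub>R (a *\<^sub>R F y)\<rbrakk> \<Longrightarrow>
      \<bar>real k * (2 * inner u (g i y + B i *v u) / (1 + (norm y)\<^sup>2))\<bar> \<le> K"
proof -
  define \<beta> where "\<beta> = norm A + (\<Sum>i\<in>UNIV. norm (B i))"
  define \<mu> where "\<mu> = \<beta> * (1 + sqrt T)"
  define \<nu> where "\<nu> = \<gamma> * (1 + \<beta> * sqrt T)"
  define C\<^sub>1 where "C\<^sub>1 = \<beta> * \<gamma> + 2 * \<beta> + \<mu> * \<nu> + \<mu>\<^sup>2 * (2 + \<nu>)"
  define l where "l = \<gamma> + 2 * \<beta>"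
  define G where "G = 2 * C + 4 * C\<^sub>1 + 2 * l\<^sup>2 + 2 * C\<^sub>1\<^sup>2"
  define D where "D = 4 * l + G"
  define c where "c = 2 * (\<mu> + 1) + 2"
  define K where "K = real k * G + (real k)\<^sup>2 * D\<^sup>2 * (1 + D) ^ k"
  define \<kappa> where "\<kappa> = 2 * (c + 1) + real k * (c + 2)"
  have \<beta>: "0 \<le> \<beta>" by (auto simp: \<beta>_def intro!: add_nonneg_nonneg sum_nonneg)
  have \<mu>: "0 \<le> \<mu>" "0 \<le> \<nu>" using \<beta> \<gamma> T by (auto simp: \<mu>_def \<nu>_def)
  have C\<^sub>1: "0 \<le> C\<^sub>1" and l: "0 \<le> l" using \<beta> \<gamma> \<mu> by (auto simp: C\<^sub>1_def l_def)
  have G: "0 \<le> G" "0 \<le> D" using C C\<^sub>1 l by (auto simp: G_def D_def)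
  have K: "0 \<le> K" "0 \<le> \<kappa>" using G \<mu> by (auto simp: K_def \<kappa>_def c_def)
  have u_bound: "norm u \<le> 2 * sqrt (1 + (norm y)\<^sup>2)"
    if "0 \<le> \<Delta>" "norm (a *\<^sub>R F y) * \<Delta> \<le> 1" "u = y + \<Delta> *\<^sub>R (a *\<^sub>R F y)" for \<Delta> a y u
  proof -
    have "norm u \<le> norm y + norm (\<Delta> *\<^sub>R (a *\<^sub>R F y))"
      unfolding that(3) by (rule norm_triangle_ineq)
    moreover have "norm (\<Delta> *\<^sub>R (a *\<^sub>R F y)) \<le> 1" using that by (simp add: abs_mult mult_ac)
    moreover have "norm y \<le> sqrt (1 + (norm y)\<^sup>2)" by (simp add: real_le_rsqrt)
    moreover have "1 \<le> sqrt (1 + (norm y)\<^sup>2)" by simp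
    ultimately show ?thesis by linarith
  qed
  show thesis
  \<comment> \<open>The second summand enlarges the constant so that it also bounds the linear coefficients.\<close>
  proof (rule that[of "K + 4 * real k * l" \<kappa>])
    fix \<Delta> a y \<xi> u X \<tau>
    assume \<Delta>: "0 \<le> \<Delta>" "\<Delta> \<le> T" and a: "0 \<le> a" "a \<le> (1 :: real)"
      and tame: "norm (a *\<^sub>R F y) * \<Delta> \<le> 1"
      and u: "u = y + \<Delta> *\<^sub>R (a *\<^sub>R F y)"
      and X: "X = matrix_exp (\<Delta> *\<^sub>R A + (\<Sum>i\<in>UNIV. \<xi> i *\<^sub>R B i))
          *v (u - \<Delta> *\<^sub>R (\<Sum>i\<in>UNIV. B i *v g i y) + (\<Sum>i\<in>UNIV. \<xi> i *\<^sub>R g i y))"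
      and \<tau>: "\<tau> = sqrt \<Delta> + (\<Sum>i\<in>UNIV. \<bar>\<xi> i\<bar>)"
    define q where "q = 1 + (norm y)\<^sup>2"
    define L where "L = (\<Sum>i\<in>UNIV. \<xi> i *\<^sub>R (g i y + B i *v u))"
    have q: "1 \<le> q" by (simp add: q_def)
    have \<tau>0: "0 \<le> \<tau>" "sqrt \<Delta> \<le> \<tau>"
      unfolding \<tau> using \<Delta> by (auto intro!: add_nonneg_nonneg sum_nonneg)
    have u2q: "norm u \<le> 2 * sqrt q" using u_bound[OF \<Delta>(1) tame u] by (simp add: q_def)
    have "\<Delta> \<le> \<tau>\<^sup>2" using power_mono[OF \<tau>0(2), of 2] \<Delta> by simp
    have u2: "(norm u)\<^sup>2 \<le> (norm y)\<^sup>2 + 2 * C * \<tau>\<^sup>2 * q"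
    proof -
      have "(norm u)\<^sup>2 \<le> (norm y)\<^sup>2 + 2 * C * \<Delta> * q"
        unfolding u q_def by (rule tamed_drift_step[OF C(2) \<Delta>(1) a C(1) tame])
      also have "\<dots> \<le> (norm y)\<^sup>2 + 2 * C * \<tau>\<^sup>2 * q"
        using \<open>\<Delta> \<le> \<tau>\<^sup>2\<close> C q by (intro add_left_mono mult_right_mono mult_left_mono) auto
      finally show ?thesis .
    qed
    have gq: "norm (g i y) \<le> \<gamma> * sqrt q" for i using \<gamma>(2) by (simp add: q_def)
    have wq: "0 \<le> sqrt q" using q by simp
    note expansion = gbm_step_expansion[where \<Delta> = \<Delta> and T = T and w = "sqrt q" and \<gamma> = \<gamma>
        and u = u and g = "\<lambda>i. g i y" and \<xi> = \<xi> and B = B and A = A,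
        OF \<Delta> wq \<gamma>(1) u2q gq, folded \<beta>_def, folded \<mu>_def \<nu>_def, folded C\<^sub>1_def l_def \<tau> L_def X]
    have "(1 + (norm (u + L + (X - u - L)))\<^sup>2) ^ k \<le> q ^ k * (1 + real k * (2 * inner u L / q)
        + K * \<tau>\<^sup>2 * exp (\<kappa> * \<tau>))"
      unfolding K_def \<kappa>_def D_def G_def c_def q_def
      by (rule lyapunov_power_expansion[OF \<tau>0(1) _ C\<^sub>1 l _ u2[unfolded q_def] u2q[unfolded q_def]
            expansion[unfolded q_def]]) (use C \<mu> in auto)
    also have "real k * (2 * inner u L / q)
        = (\<Sum>i\<in>UNIV. \<xi> i * (real k * (2 * inner u (g i y + B i *v u) / q)))"
      by (simp add: L_def inner_sum_right sum_distrib_left sum_divide_distrib mult_ac)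
    also have "q ^ k * (1 + (\<Sum>i\<in>UNIV. \<xi> i * (real k * (2 * inner u (g i y + B i *v u) / q)))
        + K * \<tau>\<^sup>2 * exp (\<kappa> * \<tau>))
      \<le> q ^ k * (1 + (\<Sum>i\<in>UNIV. \<xi> i * (real k * (2 * inner u (g i y + B i *v u) / q)))
        + (K + 4 * real k * l) * \<tau>\<^sup>2 * exp (\<kappa> * \<tau>))"
      using q l by (intro mult_left_mono add_left_mono mult_right_mono) auto
    finally show "(1 + (norm X)\<^sup>2) ^ k \<le> (1 + (norm y)\<^sup>2) ^ k * (1
        + (\<Sum>i\<in>UNIV. \<xi> i * (real k * (2 * inner u (g i y + B i *v u) / (1 + (norm y)\<^sup>2))))
        + (K + 4 * real k * l) * \<tau>\<^sup>2 * exp (\<kappa> * \<tau>))"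
      by (simp add: q_def)
  next
    fix \<Delta> a y i u
    assume "0 \<le> \<Delta>" "norm (a *\<^sub>R F y) * \<Delta> \<le> 1" "u = y + \<Delta> *\<^sub>R (a *\<^sub>R F y)"
    note u = u_bound[OF this]
    define q where "q = 1 + (norm y)\<^sup>2"
    have q: "1 \<le> q" by (simp add: q_def)
    have "norm (B i) \<le> (\<Sum>i\<in>UNIV. norm (B i))" by (rule member_le_sum) auto
    then have B: "norm (B i) \<le> \<beta>" by (simp add: \<beta>_def add_increasing)
    have "norm (g i y + B i *v u) \<le> \<gamma> * sqrt q + \<beta> * (2 * sqrt q)"
      using u \<gamma> \<beta> B by (intro norm_triangle_mono order_trans[OF norm_matrix_vector_le] mult_mono)
        (auto simp: q_def)
    also have "\<dots> = l * sqrt q" by (simp add: l_def algebra_simps)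
    finally have "\<bar>inner u (g i y + B i *v u)\<bar> \<le> (2 * sqrt q) * (l * sqrt q)"
      using u q by (intro order_trans[OF Cauchy_Schwarz_ineq2] mult_mono) (auto simp: q_def)
    also have "\<dots> = 2 * l * q" using q by (simp add: mult_ac)
    finally have "\<bar>2 * inner u (g i y + B i *v u) / q\<bar> \<le> 4 * l"
      using q by (simp add: abs_mult divide_le_eq)
    then have "\<bar>real k * (2 * inner u (g i y + B i *v u) / q)\<bar> \<le> real k * (4 * l)"
      unfolding abs_mult[of "real k"] by (intro mult_mono) auto
    then show "\<bar>real k * (2 * inner u (g i y + B i *v u) / (1 + (norm y)\<^sup>2))\<bar> \<le> K + 4 * real k * l"
      using K by (simp add: q_def)
  qed (use K l in auto)
qed

section \<open>Gaussian increments independent of the past\<close>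

text \<open>Completing the square: the density times \<open>exp (a * z)\<close> is a multiple of the normal density
shifted by \<open>a\<close>.\<close>

lemma (in prob_space) std_normal_exp_moment:
  assumes D: "distributed M lborel Z std_normal_density"
  shows "integrable M (\<lambda>\<omega>. exp (a * Z \<omega>))" "expectation (\<lambda>\<omega>. exp (a * Z \<omega>)) = exp (a\<^sup>2 / 2)"
proof -
  have eq: "std_normal_density z * exp (a * z) = exp (a\<^sup>2 / 2) * normal_density a 1 z" for z
  proof -
    have "- z\<^sup>2 / 2 + a * z = a\<^sup>2 / 2 + - ((z - a)\<^sup>2 / 2)"
      by (simp add: power2_diff field_simps)
    then have "exp (- z\<^sup>2 / 2) * exp (a * z) = exp (a\<^sup>2 / 2) * exp (- ((z - a)\<^sup>2 / 2))"
      by (simp only: mult_exp_exp)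
    then show ?thesis
      by (simp add: std_normal_density_def normal_density_def)
  qed
  have "integrable lborel (\<lambda>z. std_normal_density z * exp (a * z))"
    unfolding eq by simp
  then show "integrable M (\<lambda>\<omega>. exp (a * Z \<omega>))"
    using distributed_integrable[OF D, of "\<lambda>z. exp (a * z)"] by simp
  have "(\<integral>z. std_normal_density z * exp (a * z) \<partial>lborel) = exp (a\<^sup>2 / 2)"
    unfolding eq by simp
  then show "expectation (\<lambda>\<omega>. exp (a * Z \<omega>)) = exp (a\<^sup>2 / 2)"
    using distributed_integral[OF D, of "\<lambda>z. exp (a * z)"] by simp
qed

text \<open>Scaling to a standard normal variable \<open>Z\<close> brings out the factor \<open>\<Delta>\<close>; the exponential weight
then only sees \<open>sqrt \<Delta> \<le> sqrt T\<close>, so the constant does not depend on \<open>\<Delta>\<close>.\<close>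

lemma (in prob_space) gaussian_square_exp_moment:
  fixes X :: "'a \<Rightarrow> real"
  assumes D: "distributed M lborel X (normal_density 0 (sqrt \<Delta>))"
    and \<Delta>: "0 < \<Delta>" "\<Delta> \<le> T" and c: "0 \<le> c"
  shows "integrable M (\<lambda>\<omega>. (X \<omega>)\<^sup>2 * exp (c * \<bar>X \<omega>\<bar>))"
    and "expectation (\<lambda>\<omega>. (X \<omega>)\<^sup>2 * exp (c * \<bar>X \<omega>\<bar>)) \<le> 4 * exp ((c * sqrt T + 1)\<^sup>2 / 2) * \<Delta>"
proof -
  define a where "a = c * sqrt T + 1"
  define Z where "Z = (\<lambda>\<omega>. X \<omega> / sqrt \<Delta>)"
  have Z: "distributed M lborel Z std_normal_density"
    using D normal_standard_normal_convert[of "sqrt \<Delta>" X 0] \<Delta> by (simp add: Z_def)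
  note mgf = std_normal_exp_moment[OF Z]
  have [measurable]: "X \<in> borel_measurable M"
    using distributed_measurable[OF D] by simp
  define b where "b = (\<lambda>\<omega>. 2 * \<Delta> * (exp (a * Z \<omega>) + exp (- a * Z \<omega>)))"
  have b: "integrable M b" unfolding b_def
    by (intro integrable_mult_right Bochner_Integration.integrable_add mgf)
  have Eb: "expectation b = 4 * exp (a\<^sup>2 / 2) * \<Delta>"
    unfolding b_def using mgf[of a] mgf[of "-a"] by simp
  have le: "(X \<omega>)\<^sup>2 * exp (c * \<bar>X \<omega>\<bar>) \<le> b \<omega>" for \<omega>
  proof -
    let ?z = "\<bar>Z \<omega>\<bar>"
    have X: "\<bar>X \<omega>\<bar> = sqrt \<Delta> * ?z" using \<Delta> by (simp add: Z_def abs_divide)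
    have X2: "(X \<omega>)\<^sup>2 = \<Delta> * ?z\<^sup>2" using \<Delta> by (simp add: Z_def power_divide)
    have "?z\<^sup>2 \<le> 2 * exp ?z"
      using exp_lower_Taylor_quadratic[of ?z] by simp
    then have "(X \<omega>)\<^sup>2 * exp (c * \<bar>X \<omega>\<bar>) \<le> \<Delta> * (2 * exp ?z) * exp (c * sqrt T * ?z)"
      unfolding X2 X using \<Delta> c
      by (intro mult_mono) (auto intro!: mult_left_mono mult_right_mono simp: mult.assoc)
    also have "\<dots> = 2 * \<Delta> * exp (a * ?z)"
      by (simp add: a_def distrib_right exp_add)
    also have "\<dots> \<le> b \<omega>"
      unfolding b_def using \<Delta> by (intro mult_left_mono) (auto simp: abs_if)
    finally show ?thesis .
  qed
  show int: "integrable M (\<lambda>\<omega>. (X \<omega>)\<^sup>2 * exp (c * \<bar>X \<omega>\<bar>))"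
  proof (rule Bochner_Integration.integrable_bound[OF b])
    show "AE \<omega> in M. norm ((X \<omega>)\<^sup>2 * exp (c * \<bar>X \<omega>\<bar>)) \<le> norm (b \<omega>)"
      using le by (intro always_eventually allI) (simp add: order_trans[OF le abs_ge_self])
  qed simp
  show "expectation (\<lambda>\<omega>. (X \<omega>)\<^sup>2 * exp (c * \<bar>X \<omega>\<bar>)) \<le> 4 * exp ((c * sqrt T + 1)\<^sup>2 / 2) * \<Delta>"
    using integral_mono[OF int b le] Eb by (simp add: a_def)
qed

text \<open>Replacing each summand of \<open>\<tau>\<close> by the largest one bounds the mean of the left-hand side by
means over one increment at a time.\<close>

lemma square_exp_sum_le:
  fixes x :: "'m::finite \<Rightarrow> real" and \<Delta> c :: real
  assumes \<Delta>: "0 \<le> \<Delta>" and c: "0 \<le> c"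
  defines "\<tau> \<equiv> sqrt \<Delta> + (\<Sum>i\<in>UNIV. \<bar>x i\<bar>)" and "n \<equiv> 1 + real CARD('m)"
  shows "\<tau>\<^sup>2 * exp (c * \<tau>)
    \<le> n\<^sup>2 * (\<Delta> * exp (c * n * sqrt \<Delta>) + (\<Sum>i\<in>UNIV. (x i)\<^sup>2 * exp (c * n * \<bar>x i\<bar>)))"
proof -
  define b where "b = Max (insert (sqrt \<Delta>) (range (\<lambda>i. \<bar>x i\<bar>)))"
  have le: "sqrt \<Delta> \<le> b" "\<And>i. \<bar>x i\<bar> \<le> b"
    unfolding b_def by (rule Max_ge, simp, simp)+
  have b0: "0 \<le> b" using le(1) \<Delta> by (meson order_trans real_sqrt_ge_zero)
  have \<tau>0: "0 \<le> \<tau>" unfolding \<tau>_def using \<Delta> by (intro add_nonneg_nonneg sum_nonneg) auto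
  have "\<tau> \<le> b + (\<Sum>i\<in>(UNIV :: 'm set). b)" unfolding \<tau>_def by (intro add_mono sum_mono le)
  then have \<tau>: "\<tau> \<le> n * b" by (simp add: n_def algebra_simps)
  have "\<tau>\<^sup>2 * exp (c * \<tau>) \<le> (n * b)\<^sup>2 * exp (c * (n * b))"
    using \<tau> \<tau>0 c by (intro mult_mono power_mono) (auto intro: mult_left_mono)
  also have "\<dots> = n\<^sup>2 * (b\<^sup>2 * exp (c * n * b))" by (simp add: power_mult_distrib mult_ac)
  also have "b\<^sup>2 * exp (c * n * b)
      \<le> \<Delta> * exp (c * n * sqrt \<Delta>) + (\<Sum>i\<in>UNIV. (x i)\<^sup>2 * exp (c * n * \<bar>x i\<bar>))"
  proof -
    have "b \<in> insert (sqrt \<Delta>) (range (\<lambda>i. \<bar>x i\<bar>))" unfolding b_def by (intro Max_in) auto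
    then consider "b = sqrt \<Delta>" | i where "b = \<bar>x i\<bar>" by auto
    then show ?thesis
    proof cases
      case 1
      then show ?thesis using \<Delta> by (simp add: sum_nonneg)
    next
      case 2
      have "(x i)\<^sup>2 * exp (c * n * \<bar>x i\<bar>) \<le> (\<Sum>i\<in>UNIV. (x i)\<^sup>2 * exp (c * n * \<bar>x i\<bar>))"
        by (rule member_le_sum) auto
      then show ?thesis using 2 \<Delta> by (simp add: add_increasing)
    qed
  qed
  finally show ?thesis by (simp add: mult_left_mono)
qed

text \<open>Translates the independence of an increment from a sub-sigma-algebra, as in the notion of
Brownian motion, into independence of random variables, for which expectations factorise.\<close>

lemma (in prob_space) indep_var_of_indep_set:
  fixes X f :: "'a \<Rightarrow> real"
  assumes N: "subalgebra M N"
    and ind: "indep_set (sets N) {X -` S \<inter> space M |S. S \<in> sets borel}"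
    and X: "X \<in> borel_measurable M" and f: "f \<in> borel_measurable N"
    and h: "h \<in> borel_measurable borel"
  shows "indep_var borel f borel (\<lambda>\<omega>. h (X \<omega>) :: real)"
proof -
  have sp: "space N = space M" and sub: "sets N \<subseteq> sets M" using N by (auto simp: subalgebra_def)
  have F: "sigma_sets (space M) {f -` A \<inter> space M |A. A \<in> sets borel} \<subseteq> sets N"
    unfolding sp[symmetric] by (rule sets.sigma_sets_subset) (use f in \<open>auto simp: measurable_sets\<close>)
  have hX: "(\<lambda>\<omega>. h (X \<omega>)) \<in> borel_measurable M" using X h by measurable
  \<comment> \<open>The preimages under a single map form a sigma-algebra already.\<close>
  have G: "sigma_sets (space M) {(\<lambda>\<omega>. h (X \<omega>)) -` A \<inter> space M |A. A \<in> sets borel}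
      \<subseteq> {X -` S \<inter> space M |S. S \<in> sets borel}"
  proof -
    have "sigma_sets (space M) {(\<lambda>\<omega>. h (X \<omega>)) -` A \<inter> space M |A. A \<in> sets borel}
        = {(\<lambda>\<omega>. h (X \<omega>)) -` A \<inter> space M |A. A \<in> sets (borel :: real measure)}"
      using sigma_sets_vimage_commute[of "\<lambda>\<omega>. h (X \<omega>)" "space M" "space borel" "sets (borel :: real measure)"]
      by (simp add: sets.sigma_sets_eq[of "borel :: real measure", simplified])
    moreover have "(\<lambda>\<omega>. h (X \<omega>)) -` A \<inter> space M \<in> {X -` S \<inter> space M |S. S \<in> sets borel}"
      if "A \<in> sets borel" for A
      using measurable_sets[OF h that] by (intro CollectI exI[of _ "h -` A"]) auto
    ultimately show ?thesis by auto
  qed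
  show ?thesis
    unfolding indep_var_eq
  proof (intro conjI)
    show "random_variable borel f" using measurable_from_subalg[OF N f] .
    show "random_variable borel (\<lambda>\<omega>. h (X \<omega>))" by (rule hX)
    show "indep_set (sigma_sets (space M) {f -` A \<inter> space M |A. A \<in> sets borel})
        (sigma_sets (space M) {(\<lambda>\<omega>. h (X \<omega>)) -` A \<inter> space M |A. A \<in> sets borel})"
      unfolding indep_set_def
    proof (rule indep_sets_mono_sets[OF ind[unfolded indep_set_def]])
      fix i
      show "case_bool (sigma_sets (space M) {f -` A \<inter> space M |A. A \<in> sets borel})
          (sigma_sets (space M) {(\<lambda>\<omega>. h (X \<omega>)) -` A \<inter> space M |A. A \<in> sets borel}) i
        \<subseteq> case_bool (sets N) {X -` S \<inter> space M |S. S \<in> sets borel} i"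
        using F G by (cases i) (simp_all only: bool.case)
    qed
  qed
qed

text \<open>The probabilistic core: \<open>N\<close> is the past, \<open>V\<close> and \<open>V'\<close> are the Lyapunov function before and
after the step. The coefficients \<open>c i\<close> are known from the past, so each \<open>V * c i * \<xi> i\<close> has
mean zero; the quadratic terms factorise into the mean of \<open>V\<close> and a Gaussian moment of order
\<open>\<Delta>\<close>. Boundedness of the \<open>c i\<close> provides integrability.\<close>

lemma (in prob_space) gaussian_step_expectation:
  fixes \<xi> c :: "'m::finite \<Rightarrow> 'a \<Rightarrow> real" and V V' :: "'a \<Rightarrow> real" and \<Delta> T K L \<kappa> :: real
  defines "n \<equiv> 1 + real CARD('m)"
  defines "\<tau> \<equiv> \<lambda>\<omega>. sqrt \<Delta> + (\<Sum>i\<in>UNIV. \<bar>\<xi> i \<omega>\<bar>)"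
  assumes N: "subalgebra M N" and \<Delta>: "0 < \<Delta>" "\<Delta> \<le> T"
    and D: "\<And>i. distributed M lborel (\<xi> i) (normal_density 0 (sqrt \<Delta>))"
    and ind: "\<And>i. indep_set (sets N) {\<xi> i -` S \<inter> space M |S. S \<in> sets borel}"
    and V: "V \<in> borel_measurable N" "integrable M V" "\<And>\<omega>. 0 \<le> V \<omega>"
    and c: "\<And>i. c i \<in> borel_measurable N" "\<And>i \<omega>. \<bar>c i \<omega>\<bar> \<le> L"
    and V': "V' \<in> borel_measurable M" "\<And>\<omega>. 0 \<le> V' \<omega>"
    and K: "0 \<le> K" "0 \<le> \<kappa>"
    and step: "\<And>\<omega>. V' \<omega> \<le> V \<omega> * (1 + (\<Sum>i\<in>UNIV. \<xi> i \<omega> * c i \<omega>) + K * (\<tau> \<omega>)\<^sup>2 * exp (\<kappa> * \<tau> \<omega>))"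
  shows "integrable M V'"
    and "expectation V' \<le> (1 + K * n\<^sup>2 * (exp (\<kappa> * n * sqrt T)
        + real CARD('m) * (4 * exp ((\<kappa> * n * sqrt T + 1)\<^sup>2 / 2))) * \<Delta>) * expectation V"
proof -
  define E where "E = 4 * exp ((\<kappa> * n * sqrt T + 1)\<^sup>2 / 2)"
  define h where "h = (\<lambda>x :: real. x\<^sup>2 * exp (\<kappa> * n * \<bar>x\<bar>))"
  have h_meas: "h \<in> borel_measurable borel" by (simp add: h_def)
  have n: "0 \<le> n" by (simp add: n_def)
  have \<xi>[measurable]: "\<xi> i \<in> borel_measurable M" for i
    using distributed_measurable[OF D[of i]] by simp
  note [measurable] = measurable_from_subalg[OF N V(1)] measurable_from_subalg[OF N c(1)]
  have \<xi>int: "integrable M (\<xi> i)" for i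
  proof (rule Bochner_Integration.integrable_bound)
    \<comment> \<open>The weight \<open>exp 0\<close> puts the second moment into the form of the preceding moment bound.\<close>
    show "integrable M (\<lambda>\<omega>. 1 + (\<xi> i \<omega>)\<^sup>2 * exp (0 * \<bar>\<xi> i \<omega>\<bar>))"
      by (intro Bochner_Integration.integrable_add integrable_const
          gaussian_square_exp_moment[OF D \<Delta>]) simp
    have "\<bar>x\<bar> \<le> 1 + x\<^sup>2" for x :: real
    proof -
      have "0 \<le> (\<bar>x\<bar> - 1)\<^sup>2" "0 \<le> x\<^sup>2" by simp_all
      then show ?thesis unfolding power2_diff by simp
    qed
    then show "AE \<omega> in M. norm (\<xi> i \<omega>) \<le> norm (1 + (\<xi> i \<omega>)\<^sup>2 * exp (0 * \<bar>\<xi> i \<omega>\<bar>))"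
      by simp
  qed simp
  have \<xi>0: "expectation (\<xi> i) = 0" for i
    using normal_distributed_expectation[OF _ D] \<Delta> by simp
  have hint: "integrable M (\<lambda>\<omega>. h (\<xi> i \<omega>))" and hE: "expectation (\<lambda>\<omega>. h (\<xi> i \<omega>)) \<le> E * \<Delta>" for i
    using gaussian_square_exp_moment[OF D[of i] \<Delta>, of "\<kappa> * n"] K n by (auto simp: h_def E_def)
  have Vc: "integrable M (\<lambda>\<omega>. V \<omega> * c i \<omega>)" for i
  proof (rule Bochner_Integration.integrable_bound)
    show "integrable M (\<lambda>\<omega>. L * V \<omega>)" using V by simp
    have "\<bar>V \<omega> * c i \<omega>\<bar> \<le> \<bar>L * V \<omega>\<bar>" for \<omega>
      using mult_left_mono[OF c(2)[of i \<omega>] V(3)[of \<omega>]] V(3)[of \<omega>]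
      by (simp add: abs_mult mult.commute) (meson abs_ge_self mult_right_mono order_trans)
    then show "AE \<omega> in M. norm (V \<omega> * c i \<omega>) \<le> norm (L * V \<omega>)" by simp
  qed simp
  have ind1: "indep_var borel (\<lambda>\<omega>. V \<omega> * c i \<omega>) borel (\<xi> i)" for i
    using V(1) c(1) by (intro indep_var_of_indep_set[OF N ind \<xi>, of _ "\<lambda>x. x"]) auto
  have lin: "integrable M (\<lambda>\<omega>. V \<omega> * c i \<omega> * \<xi> i \<omega>)"
      "expectation (\<lambda>\<omega>. V \<omega> * c i \<omega> * \<xi> i \<omega>) = 0" for i
    using indep_var_integrable[OF ind1 Vc \<xi>int] indep_var_lebesgue_integral[OF ind1 Vc \<xi>int]
    by (simp_all add: \<xi>0)
  have ind2: "indep_var borel V borel (\<lambda>\<omega>. h (\<xi> i \<omega>))" for i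
    by (rule indep_var_of_indep_set[OF N ind \<xi> V(1) h_meas])
  have quad: "integrable M (\<lambda>\<omega>. V \<omega> * h (\<xi> i \<omega>))"
      "expectation (\<lambda>\<omega>. V \<omega> * h (\<xi> i \<omega>)) \<le> E * \<Delta> * expectation V" for i
  proof -
    show "integrable M (\<lambda>\<omega>. V \<omega> * h (\<xi> i \<omega>))"
      by (rule indep_var_integrable[OF ind2 V(2) hint])
    have "expectation (\<lambda>\<omega>. V \<omega> * h (\<xi> i \<omega>)) = expectation V * expectation (\<lambda>\<omega>. h (\<xi> i \<omega>))"
      by (rule indep_var_lebesgue_integral[OF ind2 V(2) hint])
    also have "\<dots> \<le> expectation V * (E * \<Delta>)"
      using V by (intro mult_left_mono hE integral_nonneg) auto
    finally show "expectation (\<lambda>\<omega>. V \<omega> * h (\<xi> i \<omega>)) \<le> E * \<Delta> * expectation V" by (simp add: mult_ac)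
  qed
  define q where "q = K * n\<^sup>2"
  have q: "0 \<le> q" using K by (simp add: q_def)
  define b where "b = (\<lambda>\<omega>. (V \<omega> + (\<Sum>i\<in>UNIV. V \<omega> * c i \<omega> * \<xi> i \<omega>))
      + (q * exp (\<kappa> * n * sqrt T) * \<Delta> * V \<omega> + q * (\<Sum>i\<in>UNIV. V \<omega> * h (\<xi> i \<omega>))))"
  have bint: "integrable M b" unfolding b_def
    by (intro Bochner_Integration.integrable_add Bochner_Integration.integrable_sum
        integrable_mult_right lin quad V)
  have le: "V' \<omega> \<le> b \<omega>" for \<omega>
  proof -
    have "(\<tau> \<omega>)\<^sup>2 * exp (\<kappa> * \<tau> \<omega>) \<le> n\<^sup>2 * (\<Delta> * exp (\<kappa> * n * sqrt \<Delta>) + (\<Sum>i\<in>UNIV. h (\<xi> i \<omega>)))"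
      using square_exp_sum_le[of \<Delta> \<kappa> "\<lambda>i. \<xi> i \<omega>"] \<Delta> K by (simp add: \<tau>_def n_def h_def)
    also have "\<dots> \<le> n\<^sup>2 * (\<Delta> * exp (\<kappa> * n * sqrt T) + (\<Sum>i\<in>UNIV. h (\<xi> i \<omega>)))"
      using \<Delta> K n by (intro mult_left_mono add_right_mono) (auto intro: mult_left_mono)
    finally have "K * ((\<tau> \<omega>)\<^sup>2 * exp (\<kappa> * \<tau> \<omega>))
        \<le> q * (\<Delta> * exp (\<kappa> * n * sqrt T) + (\<Sum>i\<in>UNIV. h (\<xi> i \<omega>)))"
      using K by (simp add: q_def mult.assoc mult_left_mono)
    then have "V' \<omega> \<le> V \<omega> * (1 + (\<Sum>i\<in>UNIV. \<xi> i \<omega> * c i \<omega>)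
        + q * (\<Delta> * exp (\<kappa> * n * sqrt T) + (\<Sum>i\<in>UNIV. h (\<xi> i \<omega>))))"
      by (intro order_trans[OF step mult_left_mono[OF add_left_mono V(3)]]) (simp add: mult.assoc)
    also have "\<dots> = b \<omega>"
      by (simp add: b_def distrib_left sum_distrib_left mult_ac)
    finally show ?thesis .
  qed
  show V'int: "integrable M V'"
    by (rule Bochner_Integration.integrable_bound[OF bint V'(1)])
      (auto simp: V'(2) intro!: order_trans[OF le abs_ge_self])
  have "expectation V' \<le> expectation b" by (rule integral_mono[OF V'int bint le])
  also have "expectation b = expectation V
      + (q * exp (\<kappa> * n * sqrt T) * \<Delta> * expectation V + q * (\<Sum>i\<in>UNIV. expectation (\<lambda>\<omega>. V \<omega> * h (\<xi> i \<omega>))))"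
    using lin quad V by (simp add: b_def)
  also have "\<dots> \<le> expectation V + (q * exp (\<kappa> * n * sqrt T) * \<Delta> * expectation V
      + q * (\<Sum>i\<in>(UNIV :: 'm set). E * \<Delta> * expectation V))"
    using q quad by (intro add_left_mono mult_left_mono sum_mono)
  also have "\<dots> = (1 + q * (exp (\<kappa> * n * sqrt T) + real CARD('m) * E) * \<Delta>) * expectation V"
    by (simp add: algebra_simps)
  finally show "expectation V' \<le> (1 + K * n\<^sup>2 * (exp (\<kappa> * n * sqrt T)
        + real CARD('m) * (4 * exp ((\<kappa> * n * sqrt T + 1)\<^sup>2 / 2))) * \<Delta>) * expectation V"
    by (simp add: q_def E_def)
qed

section \<open>Measurability of the flow and the moment bound\<close>

lemma continuous_on_matrix_vector_mult_pair:
  "continuous_on UNIV (\<lambda>z :: (real^'n^'m) \<times> (real^'n). fst z *v snd z)"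
  unfolding matrix_vector_mult_def
  by (intro continuous_on_vec_lambda continuous_intros)

lemma borel_measurable_matrix_vector_mult:
  fixes A :: "'a \<Rightarrow> real^'n^'m"
  assumes "A \<in> borel_measurable M" "v \<in> borel_measurable M"
  shows "(\<lambda>\<omega>. A \<omega> *v v \<omega>) \<in> borel_measurable M"
  by (rule borel_measurable_continuous_Pair[OF assms continuous_on_matrix_vector_mult_pair])

lemma borel_measurable_matrix_exp: "matrix_exp \<in> borel_measurable (borel :: (real^'d^'d) measure)"
proof -
  have "continuous_on UNIV (\<lambda>A :: real^'d^'d. matrix_pow A k)" for k
  proof (induction k)
    case (Suc k)
    then show ?case
      unfolding matrix_pow.simps matrix_matrix_mult_def
      by (intro continuous_on_vec_lambda continuous_intros)
  qed simp
  then have "(\<lambda>A :: real^'d^'d. matrix_pow A k) \<in> borel_measurable borel" for k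
    by (rule borel_measurable_continuous_onI)
  then show ?thesis
    unfolding matrix_exp_def[abs_def] by (intro borel_measurable_suminf borel_measurable_scaleR) auto
qed

text \<open>Reduces real exponents to integer powers of \<open>1 + \<parallel>y\<parallel>\<^sup>2\<close>, for which the expansion of the
Lyapunov function is available.\<close>

lemma lyapunov_dominates_powr:
  fixes y :: "'a::real_normed_vector"
  assumes "0 \<le> p" "p \<le> real k"
  shows "norm y powr p \<le> (1 + (norm y)\<^sup>2) ^ k"
proof -
  have "0 \<le> (norm y - 1)\<^sup>2" by simp
  then have "2 * norm y \<le> 1 + (norm y)\<^sup>2" unfolding power2_diff by simp
  then have "norm y \<le> 1 + (norm y)\<^sup>2" using norm_ge_zero[of y] by linarith
  then have "norm y powr p \<le> (1 + (norm y)\<^sup>2) powr p"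
    using assms by (intro powr_mono2) auto
  also have "\<dots> \<le> (1 + (norm y)\<^sup>2) powr real k"
    using assms by (intro powr_mono) auto
  also have "\<dots> = (1 + (norm y)\<^sup>2) ^ k"
    by (rule powr_realpow) (simp add: add_pos_nonneg)
  finally show ?thesis .
qed

theorem theorem4:
  fixes M :: "'a measure" and \<F> :: "real \<Rightarrow> 'a measure"
    and W :: "'m::finite \<Rightarrow> real \<Rightarrow> 'a \<Rightarrow> real"
    and A :: "real^'d^'d" and B :: "'m \<Rightarrow> real^'d^'d"
    and F :: "real^'d \<Rightarrow> real^'d" and g :: "'m \<Rightarrow> real^'d \<Rightarrow> real^'d"
    and \<alpha> :: "real \<Rightarrow> real^'d \<Rightarrow> real"
    and x :: "real^'d" and T r \<rho> p :: real and h :: nat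
  assumes "prob_space M" and "0 < T" and "filtration_on M T \<F>"
    and "independent_brownian_motions M T \<F> W"
    and "\<And>i. A ** B i = B i ** A"
    and "\<And>i j. B i ** B j = B j ** B i"
    and "taming_function F \<alpha>"
    and "1 \<le> h" and "C_class h F" and "\<And>i. C_class h (g i)"
    and "0 \<le> r" and "deriv_growth h (2 * r + 1) F"
    and "\<rho> \<le> r" and "\<And>i. deriv_growth h \<rho> (g i)"
    and "\<And>q::real. 0 < q \<Longrightarrow> \<exists>K::real. \<forall>y z.
           inner y (jacobian F (at z) *v y) + q * (matrix_norm (jacobian_columns g z y))\<^sup>2
             \<le> K * (norm y)\<^sup>2"
    and "\<exists>K>0. \<forall>i y z. norm (g i y - g i z) \<le> K * norm (y - z)"
    and "1 \<le> p"
  shows "(SUP N\<in>{1..}. SUP n\<in>{0..N}.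
            \<integral>\<^sup>+ \<omega>. ennreal (norm (tamed_gbm A B F g \<alpha> W T x N n \<omega>) powr p) \<partial>M) < \<infinity>"
proof -
  interpret prob_space M by fact
  have F_diff: "F differentiable (at z)" for z
    using assms(8,9) by (cases h) auto
  have F_cont: "continuous_on UNIV F"
    using F_diff by (simp add: continuous_on_eq_continuous_at differentiable_imp_continuous_within)
  obtain K\<^sub>1 where "\<forall>y z. inner y (jacobian F (at z) *v y)
      + 1 * (matrix_norm (jacobian_columns g z y))\<^sup>2 \<le> K\<^sub>1 * (norm y)\<^sup>2"
    using assms(15)[of 1] by auto
  then have "inner y (jacobian F (at z) *v y) \<le> K\<^sub>1 * (norm y)\<^sup>2" for y z
    by (smt (verit) zero_le_power2)
  note osl = jacobian_one_sided_lipschitz[OF F_diff this]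
  obtain C where C: "0 \<le> C" "\<And>y. inner y (F y) + norm (F y) / 2 \<le> C * (1 + (norm y)\<^sup>2)"
    using one_sided_lipschitz_coercive[OF F_cont osl] by blast
  obtain K\<^sub>g where K\<^sub>g: "0 < K\<^sub>g" "\<And>i y z. norm (g i y - g i z) \<le> K\<^sub>g * norm (y - z)"
    using assms(16) by blast
  define \<gamma> where "\<gamma> = (\<Sum>i\<in>UNIV. norm (g i 0)) + K\<^sub>g"
  have \<gamma>: "0 \<le> \<gamma>" "norm (g i y) \<le> \<gamma> * sqrt (1 + (norm y)\<^sup>2)" for i y
  proof -
    show "0 \<le> \<gamma>" using K\<^sub>g by (auto simp: \<gamma>_def intro!: add_nonneg_nonneg sum_nonneg)
    have g0: "norm (g i 0) \<le> (\<Sum>i\<in>UNIV. norm (g i 0))" by (rule member_le_sum) auto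
    have "norm (g i y) \<le> norm (g i 0) + norm (g i y - g i 0)" by (rule norm_triangle_sub)
    also have "\<dots> \<le> (\<Sum>i\<in>UNIV. norm (g i 0)) * 1 + K\<^sub>g * norm y"
      using g0 K\<^sub>g(2)[of i y 0] by simp
    also have "\<dots> \<le> (\<Sum>i\<in>UNIV. norm (g i 0)) * sqrt (1 + (norm y)\<^sup>2) + K\<^sub>g * sqrt (1 + (norm y)\<^sup>2)"
      using K\<^sub>g(1) by (intro add_mono mult_left_mono) (auto simp: real_le_rsqrt intro!: sum_nonneg)
    finally show "norm (g i y) \<le> \<gamma> * sqrt (1 + (norm y)\<^sup>2)" by (simp add: \<gamma>_def distrib_right)
  qed
  have g_cont: "continuous_on UNIV (g i)" for i
    using K\<^sub>g by (intro lipschitz_on_continuous_on[of K\<^sub>g] lipschitz_onI) (auto simp: dist_norm)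
  have F_meas[measurable]: "F \<in> borel_measurable borel" and g_meas[measurable]: "\<And>i. g i \<in> borel_measurable borel"
    using F_cont g_cont by (auto intro: borel_measurable_continuous_onI)
  have taming: "\<And>\<Delta>. 0 < \<Delta> \<Longrightarrow> \<alpha> \<Delta> \<in> borel_measurable borel"
      "\<And>\<Delta> y. 0 < \<Delta> \<Longrightarrow> norm (\<alpha> \<Delta> y *\<^sub>R F y) * \<Delta> \<le> 1"
      "\<And>\<Delta> y. 0 < \<Delta> \<Longrightarrow> 0 \<le> \<alpha> \<Delta> y" "\<And>\<Delta> y. 0 < \<Delta> \<Longrightarrow> \<alpha> \<Delta> y \<le> 1"
    using assms(7) unfolding taming_function_def by blast+
  have BM: "brownian_motion_on M T \<F> (W i)" for i
    using assms(4) unfolding independent_brownian_motions_def by blast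
  have filt: "\<And>t. 0 \<le> t \<Longrightarrow> t \<le> T \<Longrightarrow> subalgebra M (\<F> t)"
      "\<And>s t. 0 \<le> s \<Longrightarrow> s \<le> t \<Longrightarrow> t \<le> T \<Longrightarrow> subalgebra (\<F> t) (\<F> s)"
    using assms(3) unfolding filtration_on_def by auto

  define k where "k = nat \<lceil>p\<rceil>"
  have k: "p \<le> real k" by (simp add: k_def real_nat_ceiling_ge)
  \<comment> \<open>\<open>A'\<close> is the drift matrix in the exponent of the flow, including the Ito correction.\<close>
  define A' where "A' = A - (1/2) *\<^sub>R (\<Sum>i\<in>UNIV. B i ** B i)"
  have "0 \<le> T" using \<open>0 < T\<close> by simp
  obtain K \<kappa> where K: "0 \<le> K" "0 \<le> \<kappa>"
    and step: "\<And>\<Delta> a y \<xi> u X \<tau>. \<lbrakk>0 \<le> \<Delta>; \<Delta> \<le> T; 0 \<le> a; a \<le> 1; norm (a *\<^sub>R F y) * \<Delta> \<le> 1;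
        u = y + \<Delta> *\<^sub>R (a *\<^sub>R F y);
        X = matrix_exp (\<Delta> *\<^sub>R A' + (\<Sum>i\<in>UNIV. \<xi> i *\<^sub>R B i))
          *v (u - \<Delta> *\<^sub>R (\<Sum>i\<in>UNIV. B i *v g i y) + (\<Sum>i\<in>UNIV. \<xi> i *\<^sub>R g i y));
        \<tau> = sqrt \<Delta> + (\<Sum>i\<in>UNIV. \<bar>\<xi> i\<bar>)\<rbrakk> \<Longrightarrow>
      (1 + (norm X)\<^sup>2) ^ k \<le> (1 + (norm y)\<^sup>2) ^ k * (1
        + (\<Sum>i\<in>UNIV. \<xi> i * (real k * (2 * inner u (g i y + B i *v u) / (1 + (norm y)\<^sup>2))))
        + K * \<tau>\<^sup>2 * exp (\<kappa> * \<tau>))"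
    and coeff: "\<And>\<Delta> a y i u. \<lbrakk>0 \<le> \<Delta>; norm (a *\<^sub>R F y) * \<Delta> \<le> 1; u = y + \<Delta> *\<^sub>R (a *\<^sub>R F y)\<rbrakk> \<Longrightarrow>
      \<bar>real k * (2 * inner u (g i y + B i *v u) / (1 + (norm y)\<^sup>2))\<bar> \<le> K"
    using tamed_step_lyapunov[where A = A' and B = B and F = F and g = g and k = k,
        OF C \<gamma> \<open>0 \<le> T\<close>] by blast
  define n\<^sub>m where "n\<^sub>m = 1 + real CARD('m)"
  define R where "R = K * n\<^sub>m\<^sup>2 * (exp (\<kappa> * n\<^sub>m * sqrt T)
        + real CARD('m) * (4 * exp ((\<kappa> * n\<^sub>m * sqrt T + 1)\<^sup>2 / 2)))"
  have R: "0 \<le> R" using K by (simp add: R_def)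
  define V where "V = (\<lambda>y :: real^'d. (1 + (norm y)\<^sup>2) ^ k)"
  have V_meas[measurable]: "V \<in> borel_measurable borel" by (simp add: V_def)
  have V0: "0 \<le> V y" for y by (simp add: V_def)

  have moment: "(\<integral>\<^sup>+ \<omega>. ennreal (norm (tamed_gbm A B F g \<alpha> W T x N n \<omega>) powr p) \<partial>M)
      \<le> ennreal (exp (R * T) * V x)" if N: "1 \<le> N" and n: "n \<le> N" for N n
  proof -
    define \<Delta> where "\<Delta> = T / real N"
    have \<Delta>: "0 < \<Delta>" "\<Delta> \<le> T" and N\<Delta>: "real N * \<Delta> = T"
      using N \<open>0 < T\<close> by (auto simp: \<Delta>_def divide_le_eq mult_le_cancel_left1)
    define Y where "Y = tamed_gbm A B F g \<alpha> W T x N"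
    \<comment> \<open>Adaptedness has to be carried along: it gives the independence of \<open>Y n\<close> from the next
      increments.\<close>
    have "Y n \<in> borel_measurable (\<F> (real n * \<Delta>)) \<and> integrable M (\<lambda>\<omega>. V (Y n \<omega>))
        \<and> expectation (\<lambda>\<omega>. V (Y n \<omega>)) \<le> (1 + R * \<Delta>) ^ n * V x"
      using n
    proof (induction n)
      case 0
      then show ?case by (simp add: Y_def prob_space)
    next
      case (Suc n)
      define t where "t = real n * \<Delta>"
      define t' where "t' = real (Suc n) * \<Delta>"
      have t': "t' = t + \<Delta>" by (simp add: t_def t'_def algebra_simps)
      have "real (Suc n) * \<Delta> \<le> real N * \<Delta>"
        using Suc.prems \<Delta> by (intro mult_right_mono) auto
      then have t: "0 \<le> t" "t < t'" "t' \<le> T"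
        using \<Delta> N\<Delta> by (simp_all add: t' t_def algebra_simps)
      note IH = Suc.IH[OF Suc_leD[OF Suc.prems], folded t_def]
      have Yn: "Y n \<in> borel_measurable (\<F> t)" using IH by blast
      have sub: "subalgebra M (\<F> t)" "subalgebra M (\<F> t')" "subalgebra (\<F> t') (\<F> t)"
        using filt t by auto
      define \<xi> where "\<xi> = (\<lambda>i \<omega>. W i t' \<omega> - W i t \<omega>)"
      have W_meas: "W i s \<in> borel_measurable (\<F> s)" if "0 \<le> s" "s \<le> T" for i s
        using BM[of i] that unfolding brownian_motion_on_def by auto
      have \<xi>_meas: "\<xi> i \<in> borel_measurable (\<F> t')" for i
        unfolding \<xi>_def using W_meas[of t' i] measurable_from_subalg[OF sub(3) W_meas[of t i]] t
        by (intro borel_measurable_diff) auto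
      have \<xi>_dist: "distributed M lborel (\<xi> i) (normal_density 0 (sqrt \<Delta>))"
        and \<xi>_ind: "indep_set (sets (\<F> t)) {\<xi> i -` S \<inter> space M |S. S \<in> sets borel}" for i
      proof -
        have "distributed M lborel (\<xi> i) (normal_density 0 (sqrt (t' - t)))
            \<and> indep_set (sets (\<F> t)) {\<xi> i -` S \<inter> space M |S. S \<in> sets borel}"
          using BM[of i] t unfolding brownian_motion_on_def \<xi>_def by blast
        moreover have "t' - t = \<Delta>" by (simp add: t')
        ultimately show "distributed M lborel (\<xi> i) (normal_density 0 (sqrt \<Delta>))"
          "indep_set (sets (\<F> t)) {\<xi> i -` S \<inter> space M |S. S \<in> sets borel}" by simp_all
      qed
      define u where "u = (\<lambda>\<omega>. Y n \<omega> + \<Delta> *\<^sub>R (\<alpha> \<Delta> (Y n \<omega>) *\<^sub>R F (Y n \<omega>)))"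
      define c where "c = (\<lambda>i \<omega>. real k * (2 * inner (u \<omega>) (g i (Y n \<omega>) + B i *v u \<omega>)
          / (1 + (norm (Y n \<omega>))\<^sup>2)))"
      define \<tau> where "\<tau> = (\<lambda>\<omega>. sqrt \<Delta> + (\<Sum>i\<in>UNIV. \<bar>\<xi> i \<omega>\<bar>))"
      have Y_Suc: "Y (Suc n) \<omega> = matrix_exp (\<Delta> *\<^sub>R A' + (\<Sum>i\<in>UNIV. \<xi> i \<omega> *\<^sub>R B i))
          *v (u \<omega> - \<Delta> *\<^sub>R (\<Sum>i\<in>UNIV. B i *v g i (Y n \<omega>)) + (\<Sum>i\<in>UNIV. \<xi> i \<omega> *\<^sub>R g i (Y n \<omega>)))" for \<omega>
      proof -
        have "Y (Suc n) \<omega> = gbm_flow A B W t' t \<omega> *v (Y n \<omega> + \<Delta> *\<^sub>R (\<alpha> \<Delta> (Y n \<omega>) *\<^sub>R F (Y n \<omega>)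
            - (\<Sum>i\<in>UNIV. B i *v g i (Y n \<omega>))) + (\<Sum>i\<in>UNIV. \<xi> i \<omega> *\<^sub>R g i (Y n \<omega>)))"
          unfolding Y_def tamed_gbm.simps Let_def \<Delta>_def[symmetric] t_def t'_def \<xi>_def ..
        moreover have "t' - t = \<Delta>" by (simp add: t')
        ultimately show ?thesis
          by (simp only: gbm_flow_def A'_def \<xi>_def u_def scaleR_diff_right add_diff_eq)
      qed
      have u_meas: "u \<in> borel_measurable (\<F> t)"
        unfolding u_def using Yn taming(1)[OF \<Delta>(1)] by measurable
      have gY_meas: "(\<lambda>\<omega>. g i (Y n \<omega>)) \<in> borel_measurable (\<F> t)" for i
        using Yn by measurable
      have BgY_meas: "(\<lambda>\<omega>. B i *v g i (Y n \<omega>)) \<in> borel_measurable (\<F> t)"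
        and Bu_meas: "(\<lambda>\<omega>. B i *v u \<omega>) \<in> borel_measurable (\<F> t)" for i
        using gY_meas u_meas by (auto intro: borel_measurable_matrix_vector_mult)
      have c_meas: "c i \<in> borel_measurable (\<F> t)" for i
        unfolding c_def using u_meas gY_meas[of i] Bu_meas[of i] Yn by measurable
      have VY_meas: "(\<lambda>\<omega>. V (Y n \<omega>)) \<in> borel_measurable (\<F> t)"
        using Yn by measurable
      have Y_Suc_meas: "Y (Suc n) \<in> borel_measurable (\<F> t')"
      proof -
        note [measurable] = \<xi>_meas measurable_from_subalg[OF sub(3) u_meas]
          measurable_from_subalg[OF sub(3) gY_meas] measurable_from_subalg[OF sub(3) BgY_meas]
        have "(\<lambda>\<omega>. matrix_exp (\<Delta> *\<^sub>R A' + (\<Sum>i\<in>UNIV. \<xi> i \<omega> *\<^sub>R B i))) \<in> borel_measurable (\<F> t')"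
          by (rule measurable_compose[OF _ borel_measurable_matrix_exp]) measurable
        then have "(\<lambda>\<omega>. Y (Suc n) \<omega>) \<in> borel_measurable (\<F> t')"
          unfolding Y_Suc by (rule borel_measurable_matrix_vector_mult) measurable
        then show ?thesis by simp
      qed
      have V_Suc_meas: "(\<lambda>\<omega>. V (Y (Suc n) \<omega>)) \<in> borel_measurable M"
        using measurable_from_subalg[OF sub(2) Y_Suc_meas] by measurable
      have c_bound: "\<bar>c i \<omega>\<bar> \<le> K" for i \<omega>
        unfolding c_def u_def by (rule coeff[OF _ taming(2)[OF \<Delta>(1)]]) (use \<Delta> in auto)
      have V_step: "V (Y (Suc n) \<omega>) \<le> V (Y n \<omega>)
          * (1 + (\<Sum>i\<in>UNIV. \<xi> i \<omega> * c i \<omega>) + K * (\<tau> \<omega>)\<^sup>2 * exp (\<kappa> * \<tau> \<omega>))" for \<omega>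
        unfolding V_def c_def
        by (rule step[OF _ \<Delta>(2) taming(3)[OF \<Delta>(1)] taming(4)[OF \<Delta>(1)] taming(2)[OF \<Delta>(1)] _ Y_Suc])
          (use \<Delta> in \<open>auto simp: u_def \<tau>_def\<close>)
      have VYn: "integrable M (\<lambda>\<omega>. V (Y n \<omega>))" using IH by blast
      note E = gaussian_step_expectation[where V = "\<lambda>\<omega>. V (Y n \<omega>)" and V' = "\<lambda>\<omega>. V (Y (Suc n) \<omega>)",
          OF sub(1) \<Delta> \<xi>_dist \<xi>_ind VY_meas VYn V0 c_meas c_bound V_Suc_meas V0 K V_step[unfolded \<tau>_def],
          folded n\<^sub>m_def, folded R_def]
      have "expectation (\<lambda>\<omega>. V (Y (Suc n) \<omega>)) \<le> (1 + R * \<Delta>) * expectation (\<lambda>\<omega>. V (Y n \<omega>))"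
        by (rule E(2))
      also have "\<dots> \<le> (1 + R * \<Delta>) * ((1 + R * \<Delta>) ^ n * V x)"
        using IH R \<Delta> by (intro mult_left_mono) auto
      finally show ?case
        using Y_Suc_meas E(1) by (simp add: t'_def mult.assoc)
    qed
    then have VY: "integrable M (\<lambda>\<omega>. V (Y n \<omega>))"
      and EV: "expectation (\<lambda>\<omega>. V (Y n \<omega>)) \<le> (1 + R * \<Delta>) ^ n * V x" by auto
    have growth: "(1 + R * \<Delta>) ^ n \<le> exp (R * T)"
    proof -
      have "(1 + R * \<Delta>) ^ n \<le> exp (R * \<Delta>) ^ n"
        using R \<Delta> by (intro power_mono exp_ge_add_one_self) auto
      also have "\<dots> = exp (R * (real n * \<Delta>))" by (simp add: exp_of_nat_mult[symmetric] mult_ac)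
      also have "\<dots> \<le> exp (R * (real N * \<Delta>))"
        using R \<Delta> n by (auto intro!: mult_left_mono)
      finally show ?thesis by (simp add: N\<Delta>)
    qed
    have "(\<integral>\<^sup>+ \<omega>. ennreal (norm (Y n \<omega>) powr p) \<partial>M) \<le> (\<integral>\<^sup>+ \<omega>. ennreal (V (Y n \<omega>)) \<partial>M)"
      unfolding V_def using \<open>1 \<le> p\<close> k
      by (intro nn_integral_mono ennreal_leI lyapunov_dominates_powr) auto
    also have "\<dots> = ennreal (expectation (\<lambda>\<omega>. V (Y n \<omega>)))"
      by (rule nn_integral_eq_integral[OF VY]) (simp add: V0)
    also have "\<dots> \<le> ennreal (exp (R * T) * V x)"
      by (intro ennreal_leI order_trans[OF EV] mult_right_mono growth V0)
    finally show ?thesis unfolding Y_def .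
  qed
  have "(SUP N\<in>{1..}. SUP n\<in>{0..N}.
      \<integral>\<^sup>+ \<omega>. ennreal (norm (tamed_gbm A B F g \<alpha> W T x N n \<omega>) powr p) \<partial>M) \<le> ennreal (exp (R * T) * V x)"
    by (intro SUP_least moment) auto
  also have "\<dots> < \<infinity>" by simp
  finally show ?thesis .
qed

end
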